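(* Let $x:M^2\to\mathbb{R}^3$ be a hyperbolic centroaffine extremal surface whose centroaffine metric has Gaussian curvature $-1$, and whose difference tensor $K$ satisfies, with respect to a local orthonormal frame field $\{E_1,E_2\}$, $$K_{E_1}E_1=f_1E_1,\quad f_1>0,\qquad K_{E_1}E_2=0,\qquad K_{E_2}E_2=f_2E_2,$$ with $f_2\equiv0$. Then $x$ is centroaffinely equivalent to an open part of one of the following five types of surfaces: (i) $x_3=\frac1{x_1}+x_1(\ln x_1-\ln x_2)$; (ii) $x_2^{1-\alpha}x_3^{1+\alpha}-x_1^2=1$, $0<\alpha<1$; (iii) $x_2^{1-\alpha}x_3^{1+\alpha}-x_1^2=-1$, $\alpha>1$; (iv) $x_3^2-x_1^2\exp\big(-\frac{x_2}{x_1}\big)=1$; (v) $x_3^2-(x_1^2+x_2^2)\exp\big(\alpha\arctan\frac{x_2}{x_1}\big)=1$, $\alpha<0$.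
   Context: A centroaffine surface is an immersion $x:M^2\to\mathbb{R}^3$ whose position vector $x$ is everywhere transversal to the tangent plane. In the locally strongly convex case, with $D$ the flat connection of $\mathbb{R}^3$, write $D_Xx_*Z=x_*(\nabla_XZ)-\varepsilon\,h(X,Z)\,x$, where $\varepsilon\in\{1,-1\}$ is chosen so that $h$ is positive definite; $h$ is the centroaffine metric, and the surface is hyperbolic if $\varepsilon=-1$. With $\hat\nabla$ the Levi-Civita connection of $h$, the difference tensor is $K=\nabla-\hat\nabla$, $K_XZ=\nabla_XZ-\hat\nabla_XZ$, and the Tchebychev vector field is $T=\frac12\operatorname{tr}_hK$. The surface is centroaffine extremal if it satisfies the Euler-Lagrange equation of the area functional of $h$, i.e. $\operatorname{tr}(\hat\nabla T)=0$. Orthonormality is with respect to $h$. Two centroaffine surfaces are centroaffinely equivalent if they differ by an element of $GL(3,\mathbb{R})$. The classification is local in nature. *)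

theory Defs
  imports "HOL-Analysis.Analysis"
begin

section \<open>Smooth surfaces\<close>

text \<open>\<open>C\<^sup>k\<close> and smooth maps on an open set.\<close>

primrec Ck_on :: "nat \<Rightarrow> 'a::euclidean_space set \<Rightarrow> ('a \<Rightarrow> 'b::real_normed_vector) \<Rightarrow> bool" where
  "Ck_on 0 S f \<longleftrightarrow> continuous_on S f"
| "Ck_on (Suc k) S f \<longleftrightarrow>
     (\<forall>u\<in>S. f differentiable (at u)) \<and>
     (\<forall>v. Ck_on k S (\<lambda>u. frechet_derivative f (at u) v))"

definition smooth_on :: "'a::euclidean_space set \<Rightarrow> ('a \<Rightarrow> 'b::real_normed_vector) \<Rightarrow> bool" where
  "smooth_on S f \<longleftrightarrow> (\<forall>k. Ck_on k S f)"

text \<open>A smooth 2-manifold is a Hausdorff second countable space with a smooth atlas; a chart is a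
  pair \<open>(U, \<phi>)\<close>. The values of \<open>\<phi>\<close> outside \<open>U\<close> are irrelevant, so its inverse is
  \<open>inv_into U \<phi>\<close>, and an object on the manifold is studied through its coordinate
  representations on the open sets \<open>\<phi> ` U\<close> of the plane.\<close>

definition smooth_surface :: "'a topology \<Rightarrow> ('a set \<times> ('a \<Rightarrow> real^2)) set \<Rightarrow> bool" where
  "smooth_surface M A \<longleftrightarrow>
     Hausdorff_space M \<and> second_countable M \<and>
     (\<forall>(U, \<phi>)\<in>A. openin M U \<and> open (\<phi> ` U) \<and>
        homeomorphic_map (subtopology M U) (top_of_set (\<phi> ` U)) \<phi>) \<and>
     (\<Union>(U, \<phi>)\<in>A. U) = topspace M \<and>
     (\<forall>(U, \<phi>)\<in>A. \<forall>(V, \<psi>)\<in>A. smooth_on (\<phi> ` (U \<inter> V)) (\<psi> \<circ> inv_into U \<phi>))"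

section \<open>Riemannian metrics in coordinates\<close>

text \<open>Vector fields on an open subset of the plane are functions \<open>real^2 \<Rightarrow> real^2\<close>, and a
  Riemannian metric is a function \<open>g\<close> for which \<open>g u\<close> is the inner product at \<open>u\<close>.\<close>

type_synonym vfield = "real^2 \<Rightarrow> real^2"
type_synonym metric = "real^2 \<Rightarrow> real^2 \<Rightarrow> real^2 \<Rightarrow> real"

definition lie_bracket :: "vfield \<Rightarrow> vfield \<Rightarrow> vfield" where
  "lie_bracket X Y u =
     frechet_derivative Y (at u) (X u) - frechet_derivative X (at u) (Y u)"

text \<open>A connection differs from the coordinate derivative by a bilinear map \<open>\<Gamma>\<close> at each point
  (its Christoffel symbols). For the Levi-Civita connection \<open>\<Gamma>\<close> is singled out by being
  symmetric (no torsion) and by compatibility with the metric,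
  \<open>X (g (Y, Z)) = g (\<nabla>\<^sub>X Y, Z) + g (Y, \<nabla>\<^sub>X Z)\<close>; it is enough to state the latter for constant
  fields, for which \<open>\<nabla>\<^sub>X Y = \<Gamma> X Y\<close>.\<close>

definition christoffel :: "metric \<Rightarrow> real^2 \<Rightarrow> real^2 \<Rightarrow> real^2 \<Rightarrow> real^2" where
  "christoffel g u = (THE \<Gamma>. bilinear \<Gamma> \<and> (\<forall>v w. \<Gamma> v w = \<Gamma> w v) \<and>
     (\<forall>v w z. frechet_derivative (\<lambda>p. g p w z) (at u) v = g u (\<Gamma> v w) z + g u w (\<Gamma> v z)))"

definition levi_civita :: "metric \<Rightarrow> vfield \<Rightarrow> vfield \<Rightarrow> vfield" where
  "levi_civita g X Y u = frechet_derivative Y (at u) (X u) + christoffel g u (X u) (Y u)"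

definition riemann_curvature :: "metric \<Rightarrow> vfield \<Rightarrow> vfield \<Rightarrow> vfield \<Rightarrow> vfield" where
  "riemann_curvature g X Y Z u =
     levi_civita g X (levi_civita g Y Z) u - levi_civita g Y (levi_civita g X Z) u
     - levi_civita g (lie_bracket X Y) Z u"

definition gauss_curvature :: "metric \<Rightarrow> real^2 \<Rightarrow> real" where
  "gauss_curvature g u =
     (let X = axis 1 1; Y = axis 2 1 in
      g u (riemann_curvature g (\<lambda>_. X) (\<lambda>_. Y) (\<lambda>_. Y) u) X
        / (g u X X * g u Y Y - (g u X Y)\<^sup>2))"

definition orthonormal_pair :: "(real^2 \<Rightarrow> real^2 \<Rightarrow> real) \<Rightarrow> real^2 \<Rightarrow> real^2 \<Rightarrow> bool" where
  "orthonormal_pair b v w \<longleftrightarrow> b v v = 1 \<and> b w w = 1 \<and> b v w = 0"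

text \<open>Trace of a vector valued bilinear map with respect to an inner product \<open>b\<close>.\<close>

definition metric_trace ::
  "(real^2 \<Rightarrow> real^2 \<Rightarrow> real) \<Rightarrow> (real^2 \<Rightarrow> real^2 \<Rightarrow> real^2) \<Rightarrow> real^2" where
  "metric_trace b B = (THE t. \<forall>v w. orthonormal_pair b v w \<longrightarrow> t = B v v + B w w)"

section \<open>Centroaffine surfaces\<close>

definition centroaffine_immersion :: "(real^2) set \<Rightarrow> (real^2 \<Rightarrow> real^3) \<Rightarrow> bool" where
  "centroaffine_immersion \<Omega> x \<longleftrightarrow> smooth_on \<Omega> x \<and>
     (\<forall>u\<in>\<Omega>. inj (frechet_derivative x (at u)) \<and> x u \<notin> range (frechet_derivative x (at u)))"

text \<open>\<open>push_forward x Z\<close> is \<open>x\<^sub>*Z\<close>, and \<open>gauss_formula \<epsilon> x X Z u W r\<close> is the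
  decomposition \<open>D\<^sub>X x\<^sub>*Z = x\<^sub>*W - \<epsilon> r x\<close> at \<open>u\<close>, whose components \<open>W\<close> and \<open>r\<close> are
  \<open>\<nabla>\<^sub>X Z\<close> and \<open>h (X, Z)\<close>.\<close>

definition push_forward :: "(real^2 \<Rightarrow> real^3) \<Rightarrow> vfield \<Rightarrow> real^2 \<Rightarrow> real^3" where
  "push_forward x Z u = frechet_derivative x (at u) (Z u)"

definition gauss_formula ::
  "real \<Rightarrow> (real^2 \<Rightarrow> real^3) \<Rightarrow> vfield \<Rightarrow> vfield \<Rightarrow> real^2 \<Rightarrow> real^2 \<Rightarrow> real \<Rightarrow> bool" where
  "gauss_formula \<epsilon> x X Z u W r \<longleftrightarrow>
     frechet_derivative (push_forward x Z) (at u) (X u)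
       = frechet_derivative x (at u) W - (\<epsilon> * r) *\<^sub>R x u"

definition centroaffine_connection ::
  "real \<Rightarrow> (real^2 \<Rightarrow> real^3) \<Rightarrow> vfield \<Rightarrow> vfield \<Rightarrow> vfield" where
  "centroaffine_connection \<epsilon> x X Z u = (THE W. \<exists>r. gauss_formula \<epsilon> x X Z u W r)"

text \<open>Since \<open>h\<close> is a tensor, its value on two tangent vectors is computed with their constant
  extensions; the same is done below for the trace of the difference tensor.\<close>

definition centroaffine_metric :: "real \<Rightarrow> (real^2 \<Rightarrow> real^3) \<Rightarrow> metric" where
  "centroaffine_metric \<epsilon> x u v w = (THE r. \<exists>W. gauss_formula \<epsilon> x (\<lambda>_. v) (\<lambda>_. w) u W r)"

definition difference_tensor ::
  "real \<Rightarrow> (real^2 \<Rightarrow> real^3) \<Rightarrow> vfield \<Rightarrow> vfield \<Rightarrow> vfield" where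
  "difference_tensor \<epsilon> x X Z u =
     centroaffine_connection \<epsilon> x X Z u - levi_civita (centroaffine_metric \<epsilon> x) X Z u"

definition tchebychev :: "real \<Rightarrow> (real^2 \<Rightarrow> real^3) \<Rightarrow> vfield" where
  "tchebychev \<epsilon> x u = (1/2) *\<^sub>R metric_trace (centroaffine_metric \<epsilon> x u)
     (\<lambda>v w. difference_tensor \<epsilon> x (\<lambda>_. v) (\<lambda>_. w) u)"

text \<open>Hyperbolic: \<open>h\<close> is positive definite for the choice \<open>\<epsilon> = -1\<close>.\<close>

definition hyperbolic_centroaffine :: "(real^2) set \<Rightarrow> (real^2 \<Rightarrow> real^3) \<Rightarrow> bool" where
  "hyperbolic_centroaffine \<Omega> x \<longleftrightarrow> centroaffine_immersion \<Omega> x \<and>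
     (\<forall>u\<in>\<Omega>. \<forall>v. v \<noteq> 0 \<longrightarrow> centroaffine_metric (-1) x u v v > 0)"

text \<open>The Euler-Lagrange equation of the area functional of \<open>h\<close>: the endomorphism
  \<open>v \<mapsto> \<nabla>\<^sub>v T\<close>, with \<open>\<nabla>\<close> the Levi-Civita connection of \<open>h\<close>, is trace free.\<close>

definition centroaffine_extremal :: "real \<Rightarrow> (real^2) set \<Rightarrow> (real^2 \<Rightarrow> real^3) \<Rightarrow> bool" where
  "centroaffine_extremal \<epsilon> \<Omega> x \<longleftrightarrow>
     (\<forall>u\<in>\<Omega>. trace (matrix (\<lambda>v.
        levi_civita (centroaffine_metric \<epsilon> x) (\<lambda>_. v) (tchebychev \<epsilon> x) u)) = 0)"

definition orthonormal_frame ::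
  "metric \<Rightarrow> (real^2) set \<Rightarrow> vfield \<Rightarrow> vfield \<Rightarrow> bool" where
  "orthonormal_frame g \<Omega> X Y \<longleftrightarrow>
     smooth_on \<Omega> X \<and> smooth_on \<Omega> Y \<and> (\<forall>u\<in>\<Omega>. orthonormal_pair (g u) (X u) (Y u))"

text \<open>The immersion \<open>x\<close>, restricted to \<open>V\<close>, becomes after a linear isomorphism a bijection of
  \<open>V\<close> onto an open part of the surface \<open>S\<close>.\<close>

definition centroaffinely_equivalent_to_open_part ::
  "'a set \<Rightarrow> ('a \<Rightarrow> real^3) \<Rightarrow> (real^3) set \<Rightarrow> bool" where
  "centroaffinely_equivalent_to_open_part V x S \<longleftrightarrow>
     (\<exists>B :: real^3^3. invertible B \<and> inj_on x V \<and>
        openin (top_of_set S) ((\<lambda>q. B *v x q) ` V))"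

section \<open>The model surfaces\<close>

text \<open>Each equation is read where its expressions are defined: positive arguments of \<open>ln\<close>,
  positive bases of real powers, nonzero denominators.\<close>

definition model_log :: "(real^3) set" where
  "model_log = {p. p$1 > 0 \<and> p$2 > 0 \<and> p$3 = 1 / p$1 + p$1 * (ln (p$1) - ln (p$2))}"

definition model_power :: "real \<Rightarrow> real \<Rightarrow> (real^3) set" where
  "model_power c \<alpha> = {p. p$2 > 0 \<and> p$3 > 0 \<and>
     (p$2) powr (1 - \<alpha>) * (p$3) powr (1 + \<alpha>) - (p$1)\<^sup>2 = c}"

definition model_exp :: "(real^3) set" where
  "model_exp = {p. p$1 \<noteq> 0 \<and> (p$3)\<^sup>2 - (p$1)\<^sup>2 * exp (- (p$2 / p$1)) = 1}"

definition model_arctan :: "real \<Rightarrow> (real^3) set" where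
  "model_arctan \<alpha> = {p. p$1 \<noteq> 0 \<and>
     (p$3)\<^sup>2 - ((p$1)\<^sup>2 + (p$2)\<^sup>2) * exp (\<alpha> * arctan (p$2 / p$1)) = 1}"

end

(*
  Writing D_X for the derivative along X and e_i for the push forward of E_i, the hypotheses give
    D_1 e_1 = a e_2 + f e_1 + x,  D_1 e_2 = -a e_1,  D_2 e_1 = b e_2,  D_2 e_2 = -b e_1 + x.
  Commuting derivatives of e_1, e_2 yields b = 0, D_2 f = a f and D_2 a = a^2 - 1; extremality
  yields D_1 f = 0, and then D_1 a = 0. So rho = 1/f and tau = -a/f satisfy D_2 rho = tau,
  D_2 tau = rho, and k = rho^2 - tau^2 is constant. With s = ln |det (e_1, e_2, x)|, which has
  D_1 s = f and D_2 s = 0, the vector N = rho e_2 - tau x is constant, while C = rho x - tau e_2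
  and e_1 depend on s only, with C' = k e_1 and e_1' = e_1 + C. This constant coefficient system
  has characteristic equation r^2 - r = k, and k = 0, k > 0, -1/4 < k < 0, k = -1/4, k < -1/4
  lead to the surfaces (i), (ii), (iii), (iv), (v). For nonzero k, k x = rho C + tau N.

  Each model surface meets every open ray from the origin at most once. As (u, r) -> r x(u) is a
  local diffeomorphism, the image of a small neighbourhood is therefore open in the model.
*)
theory Submission
  imports Defs
begin

section \<open>Smooth functions\<close>

text \<open>The metric, the connection and the Christoffel symbols are definite descriptions, and f
  comes as a bare function, so all smoothness has to be recovered from x and the frame. Determinants
  do this: by Cramer's rule in a moving basis of R^3, the metric and the coefficients a, b, f are
  quotients of determinants of smooth vectors. The relation D_2 a = a^2 - 1 is a Riccati equation,
  linearised by a = -(D_2 rho) / rho; since D_2 f = a f, the function rho = 1/f is such a solution.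
  The form ds = f theta_1, with theta_1 dual to E_1, is twice the metric dual of T, and the
  logarithm of the determinant is an explicit primitive of it, so no coordinate has to be
  constructed by integration. The parameter alpha comes from the characteristic roots. If they are
  real, the exponents 1 - alpha and 1 + alpha must weight them so that s cancels; as the roots have
  sum 1 and difference sqrt(1 + 4k), alpha = 1 / sqrt(1 + 4k). If they are 1/2 + i omega and 1/2 - i
  omega, the arctangent is omega s up to a shift, and cancelling exp s forces alpha omega = -1.
  Solving for x divides by k, so k = 0 needs an integration of its own.\<close>

abbreviation dd :: "('a::euclidean_space \<Rightarrow> 'b::real_normed_vector) \<Rightarrow> 'a \<Rightarrow> 'a \<Rightarrow> 'b" where
  "dd f u \<equiv> frechet_derivative f (at u)"

lemma dd_eqI: "(f has_derivative f') (at u) \<Longrightarrow> dd f u v = f' v"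
  using frechet_derivative_at by metis

lemma has_derivative_dd: "f differentiable (at u) \<Longrightarrow> (f has_derivative dd f u) (at u)"
  using frechet_derivative_works by blast

text \<open>Functions that agree near \<open>u\<close> have the same set of derivatives there, and
  \<open>frechet_derivative\<close> is a choice from that set. Hence the equality holds without any
  differentiability.\<close>

lemma dd_cong:
  assumes "open S" "u \<in> S" "\<And>p. p \<in> S \<Longrightarrow> f p = g p"
  shows "dd f u = dd g u"
proof -
  have "(f has_derivative f') (at u) \<longleftrightarrow> (g has_derivative f') (at u)" for f'
    using has_derivative_transform_within_open[of f f' u UNIV S g]
      has_derivative_transform_within_open[of g f' u UNIV S f] assms by auto
  then show ?thesis
    by (simp add: frechet_derivative_def)
qed

lemma differentiable_cong_open:
  assumes "open S" "u \<in> S" "\<And>p. p \<in> S \<Longrightarrow> f p = g p" "f differentiable (at u)"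
  shows "g differentiable (at u)"
  using assms has_derivative_transform_within_open[of f _ u UNIV S g]
  unfolding differentiable_def by metis

text \<open>The closure properties below all pass through this: a rule computes the derivative at
  the points of \<open>S\<close> only, and the computed expression then replaces
  \<open>frechet_derivative\<close> on the open set.\<close>

lemma Ck_on_cong:
  assumes "open S" "\<And>p. p \<in> S \<Longrightarrow> f p = g p" "Ck_on k S f"
  shows "Ck_on k S g"
  using assms
proof (induction k arbitrary: f g)
  case 0
  then show ?case by (metis Ck_on.simps(1) continuous_on_cong)
next
  case (Suc k)
  have "dd f p v = dd g p v" if "p \<in> S" for p v
    using dd_cong[of S p f g] Suc.prems that by metis
  then have "Ck_on k S (\<lambda>p. dd g p v)" for v
    using Suc.IH[of "\<lambda>p. dd f p v" "\<lambda>p. dd g p v"] Suc.prems by simp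
  moreover have "g differentiable (at p)" if "p \<in> S" for p
    using differentiable_cong_open[of S p f g] Suc.prems that by simp
  ultimately show ?case by simp
qed

lemma Ck_on_SucD: "Ck_on (Suc k) S f \<Longrightarrow> Ck_on k S f"
proof (induction k arbitrary: f)
  case 0
  then show ?case
    by (auto intro!: continuous_at_imp_continuous_on differentiable_imp_continuous_within)
next
  case (Suc k)
  then show ?case by (metis Ck_on.simps(2))
qed

lemma smooth_on_differentiable: "smooth_on S f \<Longrightarrow> u \<in> S \<Longrightarrow> f differentiable (at u)"
  unfolding smooth_on_def by (metis Ck_on.simps(2))

lemma smooth_on_has_derivative:
  "smooth_on S f \<Longrightarrow> u \<in> S \<Longrightarrow> (f has_derivative dd f u) (at u)"
  using smooth_on_differentiable frechet_derivative_works by blast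

lemma smooth_on_dd: "smooth_on S f \<Longrightarrow> smooth_on S (\<lambda>u. dd f u v)"
  unfolding smooth_on_def by (metis Ck_on.simps(2))

lemma smooth_on_continuous_on: "smooth_on S f \<Longrightarrow> continuous_on S f"
  unfolding smooth_on_def by (metis Ck_on.simps(1))

lemma smooth_on_cong:
  "open S \<Longrightarrow> (\<And>p. p \<in> S \<Longrightarrow> f p = g p) \<Longrightarrow> smooth_on S f \<Longrightarrow> smooth_on S g"
  unfolding smooth_on_def using Ck_on_cong by blast

lemma Ck_on_subset: "Ck_on k S f \<Longrightarrow> T \<subseteq> S \<Longrightarrow> Ck_on k T f"
  by (induction k arbitrary: f) (auto intro: continuous_on_subset)

lemma smooth_on_subset: "smooth_on S f \<Longrightarrow> T \<subseteq> S \<Longrightarrow> smooth_on T f"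
  unfolding smooth_on_def using Ck_on_subset by blast

lemma Ck_on_const: "Ck_on k S (\<lambda>_. c)"
  by (induction k arbitrary: c) auto

lemma smooth_on_const: "smooth_on S (\<lambda>_. c)"
  by (simp add: smooth_on_def Ck_on_const)

lemma Ck_on_add:
  assumes "open S" "Ck_on k S f" "Ck_on k S g"
  shows "Ck_on k S (\<lambda>u. f u + g u)"
  using assms
proof (induction k arbitrary: f g)
  case 0
  then show ?case by (simp add: continuous_on_add)
next
  case (Suc k)
  have eq: "dd f u v + dd g u v = dd (\<lambda>u. f u + g u) u v" if "u \<in> S" for u v
    using Suc.prems that
    by (intro dd_eqI[symmetric] has_derivative_add has_derivative_dd) auto
  have ck: "Ck_on k S (\<lambda>u. dd f u v + dd g u v)" for v
    using Suc.prems by (intro Suc.IH) auto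
  have "Ck_on k S (\<lambda>u. dd (\<lambda>u. f u + g u) u v)" for v
    by (rule Ck_on_cong[OF \<open>open S\<close> _ ck]) (rule eq)
  then show ?case using Suc.prems by simp
qed

lemma smooth_on_add:
  "open S \<Longrightarrow> smooth_on S f \<Longrightarrow> smooth_on S g \<Longrightarrow> smooth_on S (\<lambda>u. f u + g u)"
  unfolding smooth_on_def using Ck_on_add by blast

text \<open>One Leibniz rule serves products, scalar multiples, inner products and the cross
  product. Each summand keeps one undifferentiated factor, whose order is lowered by
  \<open>Ck_on_SucD\<close> before the induction hypothesis applies.\<close>

lemma Ck_on_bilinear:
  fixes pr :: "'b::real_normed_vector \<Rightarrow> 'c::real_normed_vector \<Rightarrow> 'd::real_normed_vector"
  assumes "bounded_bilinear pr" "open S" "Ck_on k S f" "Ck_on k S g"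
  shows "Ck_on k S (\<lambda>u. pr (f u) (g u))"
  using assms(3,4)
proof (induction k arbitrary: f g)
  case 0
  then show ?case by (simp add: bounded_bilinear.continuous_on[OF assms(1)])
next
  case (Suc k)
  have D: "((\<lambda>u. pr (f u) (g u)) has_derivative (\<lambda>v. pr (f u) (dd g u v) + pr (dd f u v) (g u))) (at u)"
    if "u \<in> S" for u
    using Suc.prems that
    by (intro bounded_bilinear.FDERIV[OF assms(1)] has_derivative_dd) auto
  have eq: "pr (f u) (dd g u v) + pr (dd f u v) (g u) = dd (\<lambda>u. pr (f u) (g u)) u v"
    if "u \<in> S" for u v
    by (rule dd_eqI[OF D[OF that], symmetric])
  have ck: "Ck_on k S (\<lambda>u. pr (f u) (dd g u v) + pr (dd f u v) (g u))" for v
    using Suc.prems Ck_on_SucD[OF Suc.prems(1)] Ck_on_SucD[OF Suc.prems(2)]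
      Suc.IH[of f "\<lambda>u. dd g u v"] Suc.IH[of "\<lambda>u. dd f u v" g]
    by (intro Ck_on_add[OF assms(2)]) auto
  have "Ck_on k S (\<lambda>u. dd (\<lambda>u. pr (f u) (g u)) u v)" for v
    by (rule Ck_on_cong[OF assms(2) _ ck]) (rule eq)
  then show ?case using D by (auto simp: differentiable_def)
qed

lemma smooth_on_bilinear:
  "bounded_bilinear pr \<Longrightarrow> open S \<Longrightarrow> smooth_on S f \<Longrightarrow> smooth_on S g
    \<Longrightarrow> smooth_on S (\<lambda>u. pr (f u) (g u))"
  unfolding smooth_on_def using Ck_on_bilinear by blast

lemmas smooth_on_mult = smooth_on_bilinear[OF bounded_bilinear_mult]
  and smooth_on_scaleR = smooth_on_bilinear[OF bounded_bilinear_scaleR]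
  and smooth_on_inner = smooth_on_bilinear[OF bounded_bilinear_inner]

lemma smooth_on_sum:
  assumes "open S" "\<And>i. i \<in> I \<Longrightarrow> smooth_on S (f i)"
  shows "smooth_on S (\<lambda>u. \<Sum>i\<in>I. f i u)"
  using assms(2)
proof (induction I rule: infinite_finite_induct)
  case (insert i I)
  then show ?case using smooth_on_add[OF assms(1), of "f i"] by simp
qed (simp_all add: smooth_on_const)

text \<open>The derivative of 1/f is -(1/f) f' (1/f), which contains only 1/f itself and a
  derivative of the smooth f. So induction on the order works with f fixed.\<close>

lemma smooth_on_inverse:
  fixes f :: "'a::euclidean_space \<Rightarrow> real"
  assumes "open S" "smooth_on S f" "\<And>u. u \<in> S \<Longrightarrow> f u \<noteq> 0"
  shows "smooth_on S (\<lambda>u. inverse (f u))"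
proof -
  have "Ck_on k S (\<lambda>u. inverse (f u))" for k
  proof (induction k)
    case 0
    then show ?case
      using assms(3) smooth_on_continuous_on[OF assms(2)] by (simp add: continuous_on_inverse)
  next
    case (Suc k)
    have D: "((\<lambda>u. inverse (f u)) has_derivative
        (\<lambda>v. - (inverse (f u) * dd f u v * inverse (f u)))) (at u)" if "u \<in> S" for u
      by (rule Deriv.has_derivative_inverse[where f = f and x = u,
            OF assms(3)[OF that] smooth_on_has_derivative[OF assms(2) that]])
    have ck: "Ck_on k S (\<lambda>u. - (inverse (f u) * dd f u v * inverse (f u)))" for v
    proof -
      have "Ck_on k S (\<lambda>u. dd f u v)"
        using smooth_on_dd[OF assms(2)] by (simp add: smooth_on_def)
      note Ck = Ck_on_bilinear[OF bounded_bilinear_mult assms(1)]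
      have "Ck_on k S (\<lambda>u. (-1) * (inverse (f u) * dd f u v * inverse (f u)))"
        by (rule Ck[OF Ck_on_const Ck[OF Ck[OF Suc \<open>Ck_on k S (\<lambda>u. dd f u v)\<close>] Suc]])
      then show ?thesis by simp
    qed
    have eq: "- (inverse (f u) * dd f u v * inverse (f u)) = dd (\<lambda>u. inverse (f u)) u v"
      if "u \<in> S" for u v
      by (rule dd_eqI[OF D[OF that], symmetric])
    have "Ck_on k S (\<lambda>u. dd (\<lambda>u. inverse (f u)) u v)" for v
      by (rule Ck_on_cong[OF assms(1) _ ck]) (rule eq)
    then show ?case using D by (auto simp: differentiable_def)
  qed
  then show ?thesis by (simp add: smooth_on_def)
qed

lemma smooth_on_divide:
  fixes f g :: "'a::euclidean_space \<Rightarrow> real"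
  assumes "open S" "smooth_on S f" "smooth_on S g" "\<And>u. u \<in> S \<Longrightarrow> g u \<noteq> 0"
  shows "smooth_on S (\<lambda>u. f u / g u)"
  using smooth_on_mult[OF assms(1,2) smooth_on_inverse[OF assms(1,3,4)]]
  by (simp add: divide_inverse)

section \<open>Derivatives along vector fields\<close>

lemma linear_expansion:
  fixes L :: "'a::euclidean_space \<Rightarrow> 'b::real_vector"
  assumes "linear L"
  shows "L w = (\<Sum>b\<in>Basis. (w \<bullet> b) *\<^sub>R L b)"
proof -
  have "L w = L (\<Sum>b\<in>Basis. (w \<bullet> b) *\<^sub>R b)" by (simp add: euclidean_representation)
  also have "\<dots> = (\<Sum>b\<in>Basis. (w \<bullet> b) *\<^sub>R L b)"
    by (simp add: linear_sum[OF assms] linear_cmul[OF assms])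
  finally show ?thesis .
qed

text \<open>Smoothness of a field of linear maps is known for constant arguments only; expanding the
  argument in the standard basis reduces a variable argument to finitely many constant ones.\<close>

lemma smooth_on_apply_field:
  fixes G :: "'a::euclidean_space \<Rightarrow> 'c::euclidean_space \<Rightarrow> 'b::real_normed_vector"
  assumes "open S" "\<And>p. p \<in> S \<Longrightarrow> linear (G p)" "\<And>w. smooth_on S (\<lambda>p. G p w)" "smooth_on S Y"
  shows "smooth_on S (\<lambda>p. G p (Y p))"
proof (rule smooth_on_cong[OF assms(1)])
  show "(\<Sum>b\<in>Basis. (Y p \<bullet> b) *\<^sub>R G p b) = G p (Y p)" if "p \<in> S" for p
    by (rule linear_expansion[OF assms(2)[OF that], symmetric])
  show "smooth_on S (\<lambda>p. \<Sum>b\<in>Basis. (Y p \<bullet> b) *\<^sub>R G p b)"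
    using assms by (intro smooth_on_sum smooth_on_scaleR smooth_on_inner smooth_on_const) auto
qed

text \<open>Leibniz rule for the pairing of \<open>G p\<close> with \<open>Y p\<close>: one term
  freezes the argument at \<open>Y u\<close>, the other freezes the linear map at \<open>u\<close>.
  No derivative of \<open>G\<close> as an operator-valued map is involved.\<close>

lemma has_derivative_apply_field:
  fixes G :: "'a::euclidean_space \<Rightarrow> 'c::euclidean_space \<Rightarrow> 'b::real_normed_vector"
  assumes "open S" "u \<in> S" "\<And>p. p \<in> S \<Longrightarrow> linear (G p)"
    and dG: "\<And>w. (\<lambda>p. G p w) differentiable (at u)" and dY: "(Y has_derivative Y') (at u)"
  shows "((\<lambda>p. G p (Y p)) has_derivative (\<lambda>v. dd (\<lambda>p. G p (Y u)) u v + G u (Y' v))) (at u)"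
proof -
  have dG': "((\<lambda>p. G p w) has_derivative dd (\<lambda>p. G p w) u) (at u)" for w
    using dG frechet_derivative_works by blast
  have "((\<lambda>p. \<Sum>b\<in>Basis. (w \<bullet> b) *\<^sub>R G p b) has_derivative
      (\<lambda>v. \<Sum>b\<in>Basis. (w \<bullet> b) *\<^sub>R dd (\<lambda>p. G p b) u v)) (at u)" for w
    using dG' by (intro has_derivative_sum has_derivative_scaleR_right)
  then have dw: "((\<lambda>p. G p w) has_derivative
      (\<lambda>v. \<Sum>b\<in>Basis. (w \<bullet> b) *\<^sub>R dd (\<lambda>p. G p b) u v)) (at u)" for w
    by (rule has_derivative_transform_within_open[OF _ assms(1,2)])
      (rule linear_expansion[OF assms(3), symmetric])
  have 1: "dd (\<lambda>p. G p w) u v = (\<Sum>b\<in>Basis. (w \<bullet> b) *\<^sub>R dd (\<lambda>p. G p b) u v)" for w v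
    by (rule dd_eqI[OF dw])
  have 2: "((\<lambda>p. \<Sum>b\<in>Basis. (Y p \<bullet> b) *\<^sub>R G p b) has_derivative
      (\<lambda>v. \<Sum>b\<in>Basis. (Y u \<bullet> b) *\<^sub>R dd (\<lambda>p. G p b) u v + (Y' v \<bullet> b) *\<^sub>R G u b)) (at u)"
    by (intro has_derivative_sum has_derivative_scaleR has_derivative_inner_left dY dG')
  have 3: "(\<lambda>v. \<Sum>b\<in>Basis. (Y u \<bullet> b) *\<^sub>R dd (\<lambda>p. G p b) u v + (Y' v \<bullet> b) *\<^sub>R G u b)
      = (\<lambda>v. dd (\<lambda>p. G p (Y u)) u v + G u (Y' v))"
    unfolding 1[of "Y u"] linear_expansion[OF assms(3)[OF assms(2)], of "Y' _"] sum.distrib ..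
  show ?thesis
    by (rule has_derivative_transform_within_open[OF 2[unfolded 3] assms(1,2)])
      (rule linear_expansion[OF assms(3), symmetric])
qed

lemma linear_dd: "smooth_on S f \<Longrightarrow> u \<in> S \<Longrightarrow> linear (dd f u)"
  using linear_frechet_derivative smooth_on_differentiable by blast

lemma smooth_on_dd_field:
  assumes "open S" "smooth_on S f" "smooth_on S X"
  shows "smooth_on S (\<lambda>p. dd f p (X p))"
  by (rule smooth_on_apply_field[where G = "dd f" and Y = X, OF assms(1) linear_dd[OF assms(2)]
        smooth_on_dd[OF assms(2)] assms(3)])

lemma dd_dd_field:
  assumes "open S" "smooth_on S f" "smooth_on S X" "u \<in> S"
  shows "dd (\<lambda>p. dd f p (X p)) u v = dd (\<lambda>p. dd f p (X u)) u v + dd f u (dd X u v)"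
  by (rule dd_eqI[OF has_derivative_apply_field[where G = "dd f" and Y = X,
        OF assms(1,4) linear_dd[OF assms(2)] smooth_on_differentiable[OF smooth_on_dd[OF assms(2)] assms(4)]
        smooth_on_has_derivative[OF assms(3,4)]]])

section \<open>Symmetry of second derivatives and the commutator formula\<close>

text \<open>Both second derivatives are limits of the same second difference over \<open>t\<^sup>2\<close>.\<close>

lemma second_difference_mean_value:
  fixes f :: "'a::euclidean_space \<Rightarrow> real"
  assumes S: "\<And>a b. 0 \<le> a \<Longrightarrow> a \<le> t \<Longrightarrow> 0 \<le> b \<Longrightarrow> b \<le> t \<Longrightarrow> u + a *\<^sub>R v + b *\<^sub>R w \<in> S"
    and "0 < t" and f: "smooth_on S f"
  obtains a b where "0 < a" "a < t" "0 < b" "b < t"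
    "f (u + t *\<^sub>R v + t *\<^sub>R w) - f (u + t *\<^sub>R v) - f (u + t *\<^sub>R w) + f u
      = t * t * dd (\<lambda>p. dd f p v) (u + a *\<^sub>R v + b *\<^sub>R w) w"
proof -
  define g where "g a = f (u + a *\<^sub>R v + t *\<^sub>R w) - f (u + a *\<^sub>R v)" for a
  have dir: "((\<lambda>a. h (p + a *\<^sub>R z + q)) has_real_derivative dd h (p + a *\<^sub>R z + q) z) (at a)"
    if "smooth_on S h" "p + a *\<^sub>R z + q \<in> S" for h :: "'a \<Rightarrow> real" and p z q a
  proof -
    have "((\<lambda>a. h (p + a *\<^sub>R z + q)) has_derivative (\<lambda>c. dd h (p + a *\<^sub>R z + q) (c *\<^sub>R z))) (at a)"
      by (rule has_derivative_compose[where g = h and x = a and f = "\<lambda>a. p + a *\<^sub>R z + q", OF _ smooth_on_has_derivative[OF that]])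
        (auto intro!: derivative_eq_intros)
    moreover have "dd h (p + a *\<^sub>R z + q) (c *\<^sub>R z) = dd h (p + a *\<^sub>R z + q) z * c" for c
      by (simp add: linear_cmul[OF linear_dd[OF that]])
    ultimately show ?thesis by (simp add: has_field_derivative_def)
  qed
  \<comment> \<open>The mean value theorem is applied to the difference in direction
    \<open>w\<close> as a function of the step along \<open>v\<close>, and afterwards to the
    derivative along \<open>v\<close> as a function of the step along \<open>w\<close>.\<close>
  have "\<exists>a. 0 < a \<and> a < t \<and> g t - g 0
      = (t - 0) * (dd f (u + a *\<^sub>R v + t *\<^sub>R w) v - dd f (u + a *\<^sub>R v) v)"
  proof (rule MVT2[OF \<open>0 < t\<close>])
    fix a assume "0 \<le> a" "a \<le> t"
    then show "(g has_real_derivative dd f (u + a *\<^sub>R v + t *\<^sub>R w) v - dd f (u + a *\<^sub>R v) v) (at a)"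
      unfolding g_def using dir[OF f, of u a v "t *\<^sub>R w"] dir[OF f, of u a v 0]
        S[of a t] S[of a 0] \<open>0 < t\<close> by (intro DERIV_diff) auto
  qed
  then obtain a where a: "0 < a" "a < t"
    "g t - g 0 = t * (dd f (u + a *\<^sub>R v + t *\<^sub>R w) v - dd f (u + a *\<^sub>R v) v)" by auto
  have "\<exists>b. 0 < b \<and> b < t \<and> dd f (u + a *\<^sub>R v + t *\<^sub>R w) v - dd f (u + a *\<^sub>R v + 0 *\<^sub>R w) v
      = (t - 0) * dd (\<lambda>p. dd f p v) (u + a *\<^sub>R v + b *\<^sub>R w) w"
  proof (rule MVT2[OF \<open>0 < t\<close>])
    fix b assume "0 \<le> b" "b \<le> t"
    then show "((\<lambda>b. dd f (u + a *\<^sub>R v + b *\<^sub>R w) v) has_real_derivative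
        dd (\<lambda>p. dd f p v) (u + a *\<^sub>R v + b *\<^sub>R w) w) (at b)"
      using dir[OF smooth_on_dd[OF f], of "u + a *\<^sub>R v" b w 0 v] S[of a b] a by simp
  qed
  then obtain b where "0 < b" "b < t" "dd f (u + a *\<^sub>R v + t *\<^sub>R w) v - dd f (u + a *\<^sub>R v) v
      = t * dd (\<lambda>p. dd f p v) (u + a *\<^sub>R v + b *\<^sub>R w) w" by auto
  with a show thesis
    by (intro that[of a b]) (auto simp: g_def algebra_simps)
qed

text \<open>If the mixed derivatives differed by 2e at \<open>u\<close>, continuity would keep each
  within e of its value on a small parallelogram. But the second difference equals t^2 times either
  one at suitable points there, so they take a common value.\<close>

lemma dd_symmetric_real:
  fixes f :: "'a::euclidean_space \<Rightarrow> real"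
  assumes "open S" "u \<in> S" and f: "smooth_on S f"
  shows "dd (\<lambda>p. dd f p v) u w = dd (\<lambda>p. dd f p w) u v"
proof (rule ccontr)
  let ?A = "\<lambda>p. dd (\<lambda>p. dd f p v) p w" and ?B = "\<lambda>p. dd (\<lambda>p. dd f p w) p v"
  assume "?A u \<noteq> ?B u"
  define e where "e = \<bar>?A u - ?B u\<bar> / 2"
  have "e > 0" using \<open>?A u \<noteq> ?B u\<close> by (simp add: e_def)
  have cont: "continuous_on S ?A" "continuous_on S ?B"
    using f smooth_on_dd smooth_on_continuous_on by blast+
  obtain d0 where d0: "d0 > 0" "ball u d0 \<subseteq> S" using assms open_contains_ball by blast
  obtain d1 where d1: "d1 > 0" "\<And>p. p \<in> S \<Longrightarrow> dist p u < d1 \<Longrightarrow> dist (?A p) (?A u) < e"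
    using cont(1) assms(2) \<open>e > 0\<close> unfolding continuous_on_iff by blast
  obtain d2 where d2: "d2 > 0" "\<And>p. p \<in> S \<Longrightarrow> dist p u < d2 \<Longrightarrow> dist (?B p) (?B u) < e"
    using cont(2) assms(2) \<open>e > 0\<close> unfolding continuous_on_iff by blast
  define d where "d = min d0 (min d1 d2)"
  \<comment> \<open>Keeps the parallelogram spanned by t v and t w within d/2 of \<open>u\<close>;
    the summand 1 covers v = w = 0.\<close>
  define t where "t = d / (2 * (norm v + norm w + 1))"
  have N: "norm v + norm w + 1 > 0" by (simp add: add_nonneg_pos)
  have "d > 0" using d0 d1 d2 by (simp add: d_def)
  have "t > 0" using N \<open>d > 0\<close> by (simp add: t_def)
  have near: "dist (u + a *\<^sub>R v + b *\<^sub>R w) u < d" if "0 \<le> a" "a \<le> t" "0 \<le> b" "b \<le> t" for a b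
  proof -
    have "norm (a *\<^sub>R v + b *\<^sub>R w) \<le> a * norm v + b * norm w"
      using norm_triangle_ineq[of "a *\<^sub>R v" "b *\<^sub>R w"] that by simp
    also have "\<dots> \<le> t * norm v + t * norm w"
      using that by (intro add_mono mult_right_mono) auto
    also have "\<dots> \<le> t * (norm v + norm w + 1)" using \<open>t > 0\<close> by (simp add: algebra_simps)
    also have "\<dots> = d / 2" using N by (simp add: t_def field_simps)
    also have "\<dots> < d" using \<open>d > 0\<close> by simp
    finally show ?thesis by (simp add: dist_norm add.assoc)
  qed
  have inS: "u + a *\<^sub>R v + b *\<^sub>R w \<in> S" if "0 \<le> a" "a \<le> t" "0 \<le> b" "b \<le> t" for a b
    using near[OF that] d0 by (auto simp: d_def dist_commute)
  have inS': "u + b *\<^sub>R w + a *\<^sub>R v \<in> S" if "0 \<le> b" "b \<le> t" "0 \<le> a" "a \<le> t" for a b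
    using inS[of a b] that by (simp add: ac_simps)
  obtain a b where ab: "0 < a" "a < t" "0 < b" "b < t"
    "f (u + t *\<^sub>R v + t *\<^sub>R w) - f (u + t *\<^sub>R v) - f (u + t *\<^sub>R w) + f u
      = t * t * ?A (u + a *\<^sub>R v + b *\<^sub>R w)"
    by (rule second_difference_mean_value[OF inS \<open>t > 0\<close> f])
  obtain a' b' where ab': "0 < a'" "a' < t" "0 < b'" "b' < t"
    "f (u + t *\<^sub>R w + t *\<^sub>R v) - f (u + t *\<^sub>R w) - f (u + t *\<^sub>R v) + f u
      = t * t * ?B (u + a' *\<^sub>R w + b' *\<^sub>R v)"
    by (rule second_difference_mean_value[OF inS' \<open>t > 0\<close> f])
  have "t * t * ?A (u + a *\<^sub>R v + b *\<^sub>R w) = t * t * ?B (u + b' *\<^sub>R v + a' *\<^sub>R w)"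
    using ab(5) ab'(5) by (simp add: algebra_simps)
  then have eq: "?A (u + a *\<^sub>R v + b *\<^sub>R w) = ?B (u + b' *\<^sub>R v + a' *\<^sub>R w)"
    using \<open>t > 0\<close> by simp
  have "dist (?A (u + a *\<^sub>R v + b *\<^sub>R w)) (?A u) < e"
    using d1(2)[OF inS] near[of a b] ab by (simp add: d_def)
  moreover have "dist (?B (u + b' *\<^sub>R v + a' *\<^sub>R w)) (?B u) < e"
    using d2(2)[OF inS] near[of b' a'] ab' by (simp add: d_def)
  ultimately have "\<bar>?A u - ?B u\<bar> < 2 * e" unfolding eq by (simp add: dist_real_def)
  then show False by (simp add: e_def)
qed

text \<open>Taken componentwise, because the mean value theorem behind the real case fails for
  vector values.\<close>

lemma dd_symmetric:
  fixes f :: "'a::euclidean_space \<Rightarrow> 'b::euclidean_space"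
  assumes "open S" "u \<in> S" and f: "smooth_on S f"
  shows "dd (\<lambda>p. dd f p v) u w = dd (\<lambda>p. dd f p w) u v"
proof (rule euclidean_eqI)
  fix c :: 'b assume "c \<in> Basis"
  have 1: "dd (\<lambda>p. h p \<bullet> c) p z = dd h p z \<bullet> c"
    if "smooth_on S h" "p \<in> S" for h :: "'a \<Rightarrow> 'b" and p z
    by (rule dd_eqI[OF has_derivative_inner_left[OF smooth_on_has_derivative[OF that]]])
  have 2: "dd (\<lambda>p. dd f p z) u z' \<bullet> c = dd (\<lambda>p. dd (\<lambda>p. f p \<bullet> c) p z) u z'" for z z'
    using 1[OF smooth_on_dd[OF f] assms(2), of z z']
      dd_cong[OF assms(1,2), of "\<lambda>p. dd f p z \<bullet> c" "\<lambda>p. dd (\<lambda>p. f p \<bullet> c) p z"] 1[OF f, of _ z]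
    by simp
  have "smooth_on S (\<lambda>p. f p \<bullet> c)"
    using assms by (intro smooth_on_inner smooth_on_const)
  then show "dd (\<lambda>p. dd f p v) u w \<bullet> c = dd (\<lambda>p. dd f p w) u v \<bullet> c"
    unfolding 2 using dd_symmetric_real[OF assms(1,2)] by blast
qed

text \<open>The pure second derivatives cancel by symmetry and only the derivatives of the fields
  remain. For a map into R^3 this is the flatness of D, from which all integrability conditions are
  drawn.\<close>

lemma dd_commutator:
  fixes f :: "real^2 \<Rightarrow> 'b::euclidean_space"
  assumes "open S" "u \<in> S" "smooth_on S f" "smooth_on S X" "smooth_on S Y"
  shows "dd (\<lambda>p. dd f p (Y p)) u (X u) - dd (\<lambda>p. dd f p (X p)) u (Y u) = dd f u (lie_bracket X Y u)"
  using dd_dd_field[OF assms(1,3,4,2), of "Y u"] dd_dd_field[OF assms(1,3,5,2), of "X u"]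
    dd_symmetric[OF assms(1-3), of "X u" "Y u"]
  by (simp add: lie_bracket_def linear_diff[OF linear_dd[OF assms(3,2)]])

section \<open>The centroaffine metric and its Levi-Civita connection\<close>

text \<open>The determinant of three vectors of R^3, written as a scalar triple product.\<close>

definition triple :: "real^3 \<Rightarrow> real^3 \<Rightarrow> real^3 \<Rightarrow> real" where
  "triple a b c = a \<bullet> cross3 b c"

text \<open>Cramer's rule with the denominator cleared, hence valid for dependent vectors
  too.\<close>

lemma triple_expansion:
  "triple a b c *\<^sub>R z = triple z b c *\<^sub>R a + triple a z c *\<^sub>R b + triple a b z *\<^sub>R c"
  by (simp add: triple_def cross3_simps forall_3)

lemma triple_simps [simp]:
  "triple a a c = 0" "triple a b a = 0" "triple a b b = 0"
  "triple (r *\<^sub>R a) b c = r * triple a b c" "triple a (r *\<^sub>R b) c = r * triple a b c"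
  "triple a b (r *\<^sub>R c) = r * triple a b c"
  "triple (a + a') b c = triple a b c + triple a' b c"
  "triple a (b + b') c = triple a b c + triple a b' c"
  "triple a b (c + c') = triple a b c + triple a b c'"
  "triple (- a) b c = - triple a b c" "triple a (- b) c = - triple a b c"
  "triple (a - a') b c = triple a b c - triple a' b c"
  "triple a (b - b') c = triple a b c - triple a b' c"
  "triple 0 b c = 0"
  by (simp_all add: triple_def cross3_simps)

lemma smooth_on_triple:
  assumes "open S" "smooth_on S f" "smooth_on S g" "smooth_on S h"
  shows "smooth_on S (\<lambda>u. triple (f u) (g u) (h u))"
  unfolding triple_def using assms bilinear_cross bilinear_conv_bounded_bilinear
  by (intro smooth_on_inner smooth_on_bilinear[where pr = cross3]) auto

lemma plane_expansion:
  fixes w :: "real^2"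
  shows "w = w $ 1 *\<^sub>R axis 1 1 + w $ 2 *\<^sub>R axis 2 1"
  by (simp add: vec_eq_iff forall_2 axis_def)

lemma linear_plane:
  fixes L :: "real^2 \<Rightarrow> 'b::real_vector"
  assumes "linear L"
  shows "L w = w $ 1 *\<^sub>R L (axis 1 1) + w $ 2 *\<^sub>R L (axis 2 1)"
  using arg_cong[OF plane_expansion[of w], of L] by (simp add: linear_add[OF assms] linear_cmul[OF assms])

text \<open>Let n be the cross product of \<open>L v\<close> and \<open>L w\<close>, nonzero by
  independence. If the determinant vanished, q would be orthogonal to n, and Cramer's rule along
  \<open>L v\<close>, \<open>L w\<close>, n would place q in the range of \<open>L\<close>.\<close>

lemma triple_neq_0:
  fixes L :: "real^2 \<Rightarrow> real^3"
  assumes "linear L" "inj L" "q \<notin> range L"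
    and vw: "\<And>c d. c *\<^sub>R v + d *\<^sub>R w = 0 \<Longrightarrow> c = 0 \<and> d = 0"
  shows "triple (L v) (L w) q \<noteq> 0"
proof
  assume "triple (L v) (L w) q = 0"
  define n where "n = cross3 (L v) (L w)"
  have n: "triple (L v) (L w) z = z \<bullet> n" for z
    by (simp add: triple_def n_def cross3_simps)
  have zero: "c = 0 \<and> d = 0" if "c *\<^sub>R L v + d *\<^sub>R L w = 0" for c d
  proof -
    have "L (c *\<^sub>R v + d *\<^sub>R w) = L 0"
      using that assms(1) by (simp add: linear_add linear_cmul linear_0)
    then show ?thesis using assms(2) vw by (meson injD)
  qed
  have "n \<noteq> 0"
  proof
    assume "n = 0"
    then have "collinear {0, L v, L w}" by (simp add: n_def cross_eq_0)
    then obtain c d where "c *\<^sub>R L v + d *\<^sub>R L w = 0" "c \<noteq> 0 \<or> d \<noteq> 0"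
      unfolding collinear_lemma
      by (metis add.right_inverse add_0 scale_minus_left scale_one scale_zero_left zero_neq_one
          add.commute scale_zero_right)
    with zero show False by blast
  qed
  have "(n \<bullet> n) *\<^sub>R q = triple q (L w) n *\<^sub>R L v + triple (L v) q n *\<^sub>R L w"
    using triple_expansion[of "L v" "L w" n q] \<open>triple (L v) (L w) q = 0\<close> n by simp
  also have "\<dots> = L (triple q (L w) n *\<^sub>R v + triple (L v) q n *\<^sub>R w)"
    using assms(1) by (simp add: linear_add linear_cmul)
  finally have "q = L ((1 / (n \<bullet> n)) *\<^sub>R (triple q (L w) n *\<^sub>R v + triple (L v) q n *\<^sub>R w))"
    using \<open>n \<noteq> 0\<close> unfolding linear_cmul[OF assms(1)]
    by (metis divide_self_if inner_eq_zero_iff scale_one scaleR_scaleR times_divide_eq_left mult_1)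
  with assms(3) show False by blast
qed

text \<open>This is what gives the definite descriptions of the induced connection and of the metric
  their meaning.\<close>

lemma transversal_unique:
  assumes "linear L" "inj L" "q \<notin> range L" "L v + r *\<^sub>R q = L w + s *\<^sub>R q"
  shows "v = w \<and> r = s"
proof -
  have *: "L (v - w) = (s - r) *\<^sub>R q"
    using assms(4) by (simp add: linear_diff[OF assms(1)] scaleR_left_diff_distrib algebra_simps)
  have "r = s"
  proof (rule ccontr)
    assume "r \<noteq> s"
    then have "q = (1 / (s - r)) *\<^sub>R L (v - w)" using * by simp
    also have "\<dots> = L ((1 / (s - r)) *\<^sub>R (v - w))" by (simp add: linear_cmul[OF assms(1)])
    finally show False using assms(3) by blast
  qed
  moreover have "v = w"
    using * \<open>r = s\<close> assms(1,2) by (metis eq_iff_diff_eq_0 injD linear_0 scale_zero_left)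
  ultimately show ?thesis by simp
qed

section \<open>The induced connection and the metric in one chart\<close>

text \<open>The immersion read in a single chart. The abbreviation \<open>C\<close> below collects
  the Christoffel symbols of the induced connection, since constant fields are inserted.\<close>

locale hyperbolic_immersion =
  fixes \<Omega> :: "(real^2) set" and y :: "real^2 \<Rightarrow> real^3"
  assumes open_dom: "open \<Omega>" and hyp: "hyperbolic_centroaffine \<Omega> y"
begin

abbreviation "g \<equiv> centroaffine_metric (-1) y"
abbreviation "C u v w \<equiv> centroaffine_connection (-1) y (\<lambda>_. v) (\<lambda>_. w) u"

lemma smooth_y: "smooth_on \<Omega> y"
  using hyp by (simp add: hyperbolic_centroaffine_def centroaffine_immersion_def)

lemma linear_dy: "u \<in> \<Omega> \<Longrightarrow> linear (dd y u)"
  using linear_dd smooth_y by blast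

lemma inj_dy: "u \<in> \<Omega> \<Longrightarrow> inj (dd y u)"
  and transversal: "u \<in> \<Omega> \<Longrightarrow> y u \<notin> range (dd y u)"
  using hyp by (auto simp: hyperbolic_centroaffine_def centroaffine_immersion_def)

lemma unique:
  "u \<in> \<Omega> \<Longrightarrow> dd y u v + r *\<^sub>R y u = dd y u w + s *\<^sub>R y u \<Longrightarrow> v = w \<and> r = s"
  using transversal_unique[OF linear_dy inj_dy transversal] by blast

abbreviation "P u \<equiv> dd y u (axis 1 1)"
abbreviation "Q u \<equiv> dd y u (axis 2 1)"
abbreviation "y2 u v w \<equiv> dd (\<lambda>p. dd y p w) u v"

lemma triple_PQ: "u \<in> \<Omega> \<Longrightarrow> triple (P u) (Q u) (y u) \<noteq> 0"
  by (rule triple_neq_0[OF linear_dy inj_dy transversal]) (auto simp: vec_eq_iff forall_2 axis_def)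

text \<open>Cramer's rule in the basis of the two coordinate tangents and the position vector. The
  coefficients are written out so that smoothness can be read off from them.\<close>

lemma ex_decomposition:
  assumes "u \<in> \<Omega>"
  shows "z = dd y u ((triple z (Q u) (y u) / triple (P u) (Q u) (y u)) *\<^sub>R axis 1 1
      + (triple (P u) z (y u) / triple (P u) (Q u) (y u)) *\<^sub>R axis 2 1)
    + (triple (P u) (Q u) z / triple (P u) (Q u) (y u)) *\<^sub>R y u"
  (is "z = ?r")
proof -
  let ?d = "triple (P u) (Q u) (y u)"
  have "?d *\<^sub>R ?r = ?d *\<^sub>R z"
    using triple_PQ[OF assms] unfolding triple_expansion[of "P u" "Q u" "y u" z]
    by (simp add: linear_add[OF linear_dy[OF assms]] linear_cmul[OF linear_dy[OF assms]]
        scaleR_right_distrib)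
  then show ?thesis using triple_PQ[OF assms] by simp
qed

text \<open>For \<epsilon> = -1 the term -\<epsilon> r y of the Gauss formula is + r y, so any
  decomposition with a plus sign identifies both components.\<close>

lemma connection_eqI:
  assumes "u \<in> \<Omega>" "dd (push_forward y Z) u (X u) = dd y u W + r *\<^sub>R y u"
  shows "centroaffine_connection (-1) y X Z u = W"
  unfolding centroaffine_connection_def gauss_formula_def assms(2)
proof (rule the_equality)
  show "\<exists>s. dd y u W + r *\<^sub>R y u = dd y u W - (- 1 * s) *\<^sub>R y u" by (rule exI[of _ r]) simp
next
  fix V assume "\<exists>s. dd y u W + r *\<^sub>R y u = dd y u V - (- 1 * s) *\<^sub>R y u"
  then obtain s where "dd y u W + r *\<^sub>R y u = dd y u V - (- 1 * s) *\<^sub>R y u" ..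
  then have "dd y u V + s *\<^sub>R y u = dd y u W + r *\<^sub>R y u" by simp
  then show "V = W" using unique[OF assms(1)] by blast
qed

lemma metric_eqI:
  assumes "u \<in> \<Omega>" "y2 u v w = dd y u W + r *\<^sub>R y u"
  shows "g u v w = r"
proof -
  have *: "dd (push_forward y (\<lambda>_. w)) u v = dd y u W + r *\<^sub>R y u"
    using assms(2) by (simp add: push_forward_def[abs_def])
  show ?thesis
    unfolding centroaffine_metric_def gauss_formula_def
  proof (rule the_equality)
    show "\<exists>V. dd (push_forward y (\<lambda>_. w)) u v = dd y u V - (- 1 * r) *\<^sub>R y u"
      using * by (intro exI[of _ W]) simp
    fix s assume "\<exists>V. dd (push_forward y (\<lambda>_. w)) u v = dd y u V - (- 1 * s) *\<^sub>R y u"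
    then obtain V where "dd (push_forward y (\<lambda>_. w)) u v = dd y u V - (- 1 * s) *\<^sub>R y u" ..
    then have "dd y u V + s *\<^sub>R y u = dd y u W + r *\<^sub>R y u" using * by simp
    then show "s = r" using unique[OF assms(1)] by blast
  qed
qed

lemma gauss: "u \<in> \<Omega> \<Longrightarrow> y2 u v w = dd y u (C u v w) + g u v w *\<^sub>R y u"
  using ex_decomposition[of u "y2 u v w"] connection_eqI[of u "\<lambda>_. w" "\<lambda>_. v"] metric_eqI[of u w v]
  by (simp add: push_forward_def[abs_def])

text \<open>The source of the smoothness of the metric: a quotient of determinants in place of a
  definite description.\<close>

lemma metric_eq:
  "u \<in> \<Omega> \<Longrightarrow> g u v w = triple (P u) (Q u) (y2 u v w) / triple (P u) (Q u) (y u)"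
  using ex_decomposition[of u "y2 u v w"] by (intro metric_eqI)

lemma smooth_g: "smooth_on \<Omega> (\<lambda>u. g u v w)"
proof (rule smooth_on_cong[OF open_dom])
  show "triple (P u) (Q u) (y2 u v w) / triple (P u) (Q u) (y u) = g u v w" if "u \<in> \<Omega>" for u
    using metric_eq[OF that] by simp
  show "smooth_on \<Omega> (\<lambda>u. triple (P u) (Q u) (y2 u v w) / triple (P u) (Q u) (y u))"
    using triple_PQ by (intro smooth_on_divide smooth_on_triple open_dom smooth_on_dd smooth_y)
qed

lemma y2_symmetric: "u \<in> \<Omega> \<Longrightarrow> y2 u v w = y2 u w v"
  using dd_symmetric[OF open_dom _ smooth_y] by blast

lemma symmetric_C: "u \<in> \<Omega> \<Longrightarrow> C u v w = C u w v"
  and symmetric_g: "u \<in> \<Omega> \<Longrightarrow> g u v w = g u w v"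
  using unique[of u "C u v w" "g u v w" "C u w v" "g u w v"] gauss[of u w v] gauss[of u v w]
    y2_symmetric[of u v w] by simp_all

text \<open>The second derivative of y is linear in the direction; uniqueness of the decomposition
  passes this on to both components.\<close>

lemma linear_C: "u \<in> \<Omega> \<Longrightarrow> linear (\<lambda>v. C u v w)"
  and linear_g: "u \<in> \<Omega> \<Longrightarrow> linear (\<lambda>v. g u v w)"
proof -
  assume u: "u \<in> \<Omega>"
  note lin = linear_dd[OF smooth_on_dd[OF smooth_y] u]
  have "C u (v + v') w = C u v w + C u v' w \<and> g u (v + v') w = g u v w + g u v' w" for v v'
    using gauss[OF u, of w "v + v'"] gauss[OF u, of w v] gauss[OF u, of w v']
    by (intro unique[OF u]) (simp add: linear_add[OF lin] linear_add[OF linear_dy[OF u]] algebra_simps)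
  moreover have "C u (c *\<^sub>R v) w = c *\<^sub>R C u v w \<and> g u (c *\<^sub>R v) w = c * g u v w" for c v
    using gauss[OF u, of w "c *\<^sub>R v"] gauss[OF u, of w v]
    by (intro unique[OF u]) (simp add: linear_cmul[OF lin] linear_cmul[OF linear_dy[OF u]] algebra_simps)
  ultimately show "linear (\<lambda>v. C u v w)" "linear (\<lambda>v. g u v w)"
    by (auto intro!: linearI)
qed

lemma bilinear_C: "u \<in> \<Omega> \<Longrightarrow> bilinear (C u)"
  and bilinear_g: "u \<in> \<Omega> \<Longrightarrow> bilinear (g u)"
  using linear_C linear_g symmetric_C symmetric_g by (simp_all add: bilinear_def)

text \<open>Differentiating the push forward of a variable field adds the tangential term
  \<open>dd Z u (X u)\<close> and leaves the transversal component unchanged, so the metric is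
  tensorial.\<close>

lemma connection_field:
  assumes "u \<in> W" "open W" "W \<subseteq> \<Omega>" "smooth_on W Z"
  shows "dd (push_forward y Z) u (X u) = dd y u (centroaffine_connection (-1) y X Z u) + g u (X u) (Z u) *\<^sub>R y u"
    and "centroaffine_connection (-1) y X Z u = C u (X u) (Z u) + dd Z u (X u)"
proof -
  have u: "u \<in> \<Omega>" using assms by blast
  have *: "dd (push_forward y Z) u (X u)
      = dd y u (C u (X u) (Z u) + dd Z u (X u)) + g u (X u) (Z u) *\<^sub>R y u"
    using dd_dd_field[OF assms(2) smooth_on_subset[OF smooth_y assms(3)] assms(4,1), of "X u"]
      gauss[OF u, of "Z u" "X u"] linear_add[OF linear_dy[OF u]]
    by (simp add: push_forward_def[abs_def])
  show "centroaffine_connection (-1) y X Z u = C u (X u) (Z u) + dd Z u (X u)"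
    by (rule connection_eqI[where X = X, OF u *])
  with * show "dd (push_forward y Z) u (X u)
      = dd y u (centroaffine_connection (-1) y X Z u) + g u (X u) (Z u) *\<^sub>R y u" by simp
qed

end

section \<open>Orthonormal pairs and traces in the plane\<close>

text \<open>The pair is a basis: if the coordinate determinant d were 0, then w_i v - v_i w = 0 for
  both i, and pairing with v gives w = 0 against b(w, w) = 1. Cramer's rule then gives coefficients,
  which pairing with v and w identifies.\<close>

lemma orthonormal_expansion:
  assumes "bilinear b" "\<And>v w. b v w = b w v" "orthonormal_pair b v w"
  shows "z = b z v *\<^sub>R v + b z w *\<^sub>R w"
proof -
  note b = bilinear_ladd[OF assms(1)] bilinear_lmul[OF assms(1)] bilinear_lsub[OF assms(1)]
    bilinear_lzero[OF assms(1)]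
  have vw: "b v v = 1" "b w w = 1" "b v w = 0" "b w v = 0"
    using assms(2,3) by (auto simp: orthonormal_pair_def)
  define d where "d = v $ 1 * w $ 2 - v $ 2 * w $ 1"
  have "d \<noteq> 0"
  proof
    assume "d = 0"
    then have "w $ 1 *\<^sub>R v - v $ 1 *\<^sub>R w = 0" "w $ 2 *\<^sub>R v - v $ 2 *\<^sub>R w = 0"
      by (simp_all add: vec_eq_iff forall_2 d_def algebra_simps)
    then have "b (w $ 1 *\<^sub>R v - v $ 1 *\<^sub>R w) v = 0" "b (w $ 2 *\<^sub>R v - v $ 2 *\<^sub>R w) v = 0"
      using b by simp_all
    then have "w = 0" using vw by (simp add: b vec_eq_iff forall_2)
    then show False using vw b by simp
  qed
  define \<alpha> \<beta> where "\<alpha> = (z $ 1 * w $ 2 - z $ 2 * w $ 1) / d" and "\<beta> = (v $ 1 * z $ 2 - v $ 2 * z $ 1) / d"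
  have z: "z = \<alpha> *\<^sub>R v + \<beta> *\<^sub>R w"
  proof -
    have "d * z $ i = (d * \<alpha>) * v $ i + (d * \<beta>) * w $ i" for i
      using \<open>d \<noteq> 0\<close> exhaust_2[of i] by (auto simp: \<alpha>_def \<beta>_def) (auto simp: d_def algebra_simps)
    then have "d * z $ i = d * (\<alpha> *\<^sub>R v + \<beta> *\<^sub>R w) $ i" for i by (simp add: algebra_simps)
    then show ?thesis using \<open>d \<noteq> 0\<close> by (simp add: vec_eq_iff)
  qed
  have "b z v = \<alpha>" "b z w = \<beta>" using vw by (simp_all add: z b)
  then show ?thesis using z by simp
qed

text \<open>Bridges the extremality condition, a trace in coordinates, and the moving frame in which
  the structure equations are written.\<close>

lemma trace_frame:
  fixes L :: "real^2 \<Rightarrow> real^2"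
  assumes "linear L" "bilinear b" "\<And>v w. b v w = b w v" "orthonormal_pair b v w"
  shows "trace (matrix L) = b (L v) v + b (L w) w"
proof -
  have Lz: "L z = b (L z) v *\<^sub>R v + b (L z) w *\<^sub>R w" for z
    by (rule orthonormal_expansion[OF assms(2-4)])
  have e: "axis i 1 = b (axis i 1) v *\<^sub>R v + b (axis i 1) w *\<^sub>R w" for i :: 2
    by (rule orthonormal_expansion[OF assms(2-4)])
  have Le: "L (axis i 1) = b (axis i 1) v *\<^sub>R L v + b (axis i 1) w *\<^sub>R L w" for i :: 2
    by (subst e) (simp add: linear_add[OF assms(1)] linear_cmul[OF assms(1)])
  note bl = bilinear_ladd[OF assms(2)] bilinear_lmul[OF assms(2)]
  have r: "b z x = z $ 1 * b (axis 1 1) x + z $ 2 * b (axis 2 1) x" for z x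
    using plane_expansion[of z] by (metis bl real_scaleR_def)
  have "trace (matrix L) = L (axis 1 1) $ 1 + L (axis 2 1) $ 2"
    by (simp add: trace_def matrix_def sum_2)
  also have "\<dots> = b (axis 1 1) v * L v $ 1 + b (axis 1 1) w * L w $ 1
      + (b (axis 2 1) v * L v $ 2 + b (axis 2 1) w * L w $ 2)"
    unfolding Le by simp
  also have "\<dots> = b (L v) v + b (L w) w"
    unfolding r[of "L v"] r[of "L w"] by simp
  finally show ?thesis .
qed

lemma linear_dd_param:
  fixes G :: "'a::euclidean_space \<Rightarrow> 'c::euclidean_space \<Rightarrow> 'b::real_normed_vector"
  assumes "open S" "u \<in> S" "\<And>p. p \<in> S \<Longrightarrow> linear (G p)" "\<And>w. smooth_on S (\<lambda>p. G p w)"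
  shows "linear (\<lambda>w. dd (\<lambda>p. G p w) u v)"
proof (rule linearI)
  note D = smooth_on_has_derivative[OF assms(4) assms(2)]
  fix w w' c
  have "dd (\<lambda>p. G p (w + w')) u v = dd (\<lambda>p. G p w + G p w') u v"
    using dd_cong[OF assms(1,2), of "\<lambda>p. G p (w + w')" "\<lambda>p. G p w + G p w'"]
      linear_add[OF assms(3)] by simp
  also have "\<dots> = dd (\<lambda>p. G p w) u v + dd (\<lambda>p. G p w') u v"
    by (rule dd_eqI[OF has_derivative_add[OF D D]])
  finally show "dd (\<lambda>p. G p (w + w')) u v = dd (\<lambda>p. G p w) u v + dd (\<lambda>p. G p w') u v" .
  have "dd (\<lambda>p. G p (c *\<^sub>R w)) u v = dd (\<lambda>p. c *\<^sub>R G p w) u v"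
    using dd_cong[OF assms(1,2), of "\<lambda>p. G p (c *\<^sub>R w)" "\<lambda>p. c *\<^sub>R G p w"]
      linear_cmul[OF assms(3)] by simp
  also have "\<dots> = c *\<^sub>R dd (\<lambda>p. G p w) u v"
    by (rule dd_eqI[OF has_derivative_scaleR_right[OF D]])
  finally show "dd (\<lambda>p. G p (c *\<^sub>R w)) u v = c *\<^sub>R dd (\<lambda>p. G p w) u v" .
qed

section \<open>The Levi-Civita connection through the Koszul formula\<close>

context hyperbolic_immersion
begin

abbreviation "dg u v w z \<equiv> dd (\<lambda>p. g p w z) u v"

text \<open>The Koszul formula for g(\<nabla>_v w, z) on constant fields, where all bracket terms
  vanish.\<close>

definition koszul :: "real^2 \<Rightarrow> real^2 \<Rightarrow> real^2 \<Rightarrow> real^2 \<Rightarrow> real" where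
  "koszul u v w z = (dg u v w z + dg u w v z - dg u z v w) / 2"

lemma dg_symmetric: "u \<in> \<Omega> \<Longrightarrow> dg u v w z = dg u v z w"
  using dd_cong[OF open_dom, of u "\<lambda>p. g p w z" "\<lambda>p. g p z w"] symmetric_g by simp

lemma linear_dg:
  assumes "u \<in> \<Omega>"
  shows "linear (\<lambda>v. dg u v w z)" "linear (\<lambda>w. dg u v w z)" "linear (\<lambda>z. dg u v w z)"
proof -
  show "linear (\<lambda>v. dg u v w z)" using linear_dd[OF smooth_g assms] by simp
  show "linear (\<lambda>w. dg u v w z)" for v z
    by (rule linear_dd_param[where G = "\<lambda>p w. g p w z", OF open_dom assms linear_g smooth_g])
  then have "linear (\<lambda>z. dg u v z w)" .
  then show "linear (\<lambda>z. dg u v w z)" using dg_symmetric[OF assms] by simp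
qed

lemma linear_koszul:
  assumes "u \<in> \<Omega>"
  shows "linear (\<lambda>v. koszul u v w z)" "linear (\<lambda>w. koszul u v w z)" "linear (\<lambda>z. koszul u v w z)"
proof -
  have *: "linear (\<lambda>x. (p x + q x - r x) / 2)" if "linear p" "linear q" "linear r"
    for p q r :: "real^2 \<Rightarrow> real"
    using linear_compose_scale_right[OF linear_compose_sub[OF linear_compose_add[OF that(1,2)] that(3)], of "1/2"]
    by simp
  show "linear (\<lambda>v. koszul u v w z)" "linear (\<lambda>w. koszul u v w z)" "linear (\<lambda>z. koszul u v w z)"
    unfolding koszul_def by (intro * linear_dg[OF assms])+
qed

text \<open>Existence: the last index of the Koszul form is raised with the orthonormal pair, which
  avoids inverting the metric. Uniqueness: combining the three cyclic compatibility identities with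
  symmetry recovers the Koszul form.\<close>

lemma christoffel_spec:
  assumes u: "u \<in> \<Omega>" and EF: "orthonormal_pair (g u) E F"
  shows "bilinear (christoffel g u)" "christoffel g u v w = christoffel g u w v"
    "dg u v w z = g u (christoffel g u v w) z + g u w (christoffel g u v z)"
proof -
  let ?spec = "\<lambda>\<Gamma>. bilinear \<Gamma> \<and> (\<forall>v w. \<Gamma> v w = \<Gamma> w v) \<and>
     (\<forall>v w z. dg u v w z = g u (\<Gamma> v w) z + g u w (\<Gamma> v z))"
  note ex = orthonormal_expansion[OF bilinear_g[OF u] symmetric_g[OF u] EF]
  have kz: "koszul u v w z = g u (koszul u v w E *\<^sub>R E + koszul u v w F *\<^sub>R F) z" for v w z
    using arg_cong[OF ex[of z], of "koszul u v w"] linear_koszul(3)[OF u, of v w]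
    by (simp add: linear_add linear_cmul bilinear_ladd[OF bilinear_g[OF u]]
        bilinear_lmul[OF bilinear_g[OF u]] symmetric_g[OF u, of z] mult.commute)
  have ks: "koszul u v w z = koszul u w v z" for v w z
    using dg_symmetric[OF u] by (simp add: koszul_def)
  have ex1: "?spec (\<lambda>v w. koszul u v w E *\<^sub>R E + koszul u v w F *\<^sub>R F)"
  proof (intro conjI allI)
    show "bilinear (\<lambda>v w. koszul u v w E *\<^sub>R E + koszul u v w F *\<^sub>R F)"
      using linear_koszul[OF u] unfolding bilinear_def linear_iff by (auto simp: algebra_simps)
    show "koszul u v w E *\<^sub>R E + koszul u v w F *\<^sub>R F = koszul u w v E *\<^sub>R E + koszul u w v F *\<^sub>R F" for v w
      by (simp add: ks[of v w])
    show "dg u v w z = g u (koszul u v w E *\<^sub>R E + koszul u v w F *\<^sub>R F) z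
        + g u w (koszul u v z E *\<^sub>R E + koszul u v z F *\<^sub>R F)" for v w z
      using kz[of v w z] kz[of v z w] dg_symmetric[OF u]
      by (simp add: symmetric_g[OF u, of w] koszul_def field_simps)
  qed
  have uniq: "\<Gamma> = \<Delta>" if "?spec \<Gamma>" "?spec \<Delta>" for \<Gamma> \<Delta>
  proof (intro ext)
    fix v w
    have "g u (\<Gamma> v w) z = koszul u v w z" if "?spec \<Gamma>" for \<Gamma> z
    proof -
      have s: "\<Gamma> z v = \<Gamma> v z" "\<Gamma> z w = \<Gamma> w z" "\<Gamma> w v = \<Gamma> v w" using that by blast+
      have "dg u v w z = g u (\<Gamma> v w) z + g u w (\<Gamma> v z)" "dg u w v z = g u (\<Gamma> v w) z + g u v (\<Gamma> w z)"
        "dg u z v w = g u (\<Gamma> v z) w + g u v (\<Gamma> w z)"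
        using that s by metis+
      then show ?thesis using symmetric_g[OF u, of "\<Gamma> v z" w] by (simp add: koszul_def)
    qed
    then show "\<Gamma> v w = \<Delta> v w" using ex[of "\<Gamma> v w"] ex[of "\<Delta> v w"] \<open>?spec \<Gamma>\<close> \<open>?spec \<Delta>\<close> by metis
  qed
  have "?spec (christoffel g u)"
    unfolding christoffel_def by (rule theI[where P = ?spec, OF ex1 uniq[OF _ ex1]])
  then show "bilinear (christoffel g u)" "christoffel g u v w = christoffel g u w v"
    "dg u v w z = g u (christoffel g u v w) z + g u w (christoffel g u v z)" by blast+
qed

text \<open>The defining compatibility speaks of constant fields. Applying the Leibniz rule for
  fields once in each argument adds exactly the derivative terms of
  \<open>levi_civita\<close>.\<close>

lemma levi_civita_compat:
  assumes "open W" "W \<subseteq> \<Omega>" "u \<in> W" "smooth_on W X" "smooth_on W Y"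
    and EF: "orthonormal_pair (g u) E F"
  shows "dd (\<lambda>p. g p (X p) (Y p)) u v
    = g u (levi_civita g (\<lambda>_. v) X u) (Y u) + g u (X u) (levi_civita g (\<lambda>_. v) Y u)"
proof -
  have u: "u \<in> \<Omega>" and sub: "\<And>p. p \<in> W \<Longrightarrow> p \<in> \<Omega>" using assms by auto
  note sg = smooth_on_subset[OF smooth_g assms(2)]
  have sX: "smooth_on W (\<lambda>p. g p (X p) w)" for w
    by (rule smooth_on_apply_field[where G = "\<lambda>p v. g p v w" and Y = X, OF assms(1) linear_g[OF sub] sg assms(4)])
  have lin2: "linear (\<lambda>w. g p v w)" if "p \<in> W" for p v
    using linear_g[OF sub[OF that], of v] symmetric_g[OF sub[OF that], of v] by simp
  have "dd (\<lambda>p. g p (X p) (Y p)) u v = dd (\<lambda>p. g p (X p) (Y u)) u v + g u (X u) (dd Y u v)"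
    by (rule dd_eqI[OF has_derivative_apply_field[where G = "\<lambda>p w. g p (X p) w" and Y = Y,
          OF assms(1,3) lin2 smooth_on_differentiable[OF sX assms(3)]
          smooth_on_has_derivative[OF assms(5,3)]]])
  also have "dd (\<lambda>p. g p (X p) (Y u)) u v = dg u v (X u) (Y u) + g u (dd X u v) (Y u)"
    by (rule dd_eqI[OF has_derivative_apply_field[where G = "\<lambda>p w. g p w (Y u)" and Y = X,
          OF assms(1,3) linear_g[OF sub] smooth_on_differentiable[OF sg assms(3)]
          smooth_on_has_derivative[OF assms(4,3)]]])
  also have "dg u v (X u) (Y u) = g u (christoffel g u v (X u)) (Y u) + g u (X u) (christoffel g u v (Y u))"
    by (rule christoffel_spec(3)[OF u EF])
  finally show ?thesis
    by (simp add: levi_civita_def bilinear_ladd[OF bilinear_g[OF u]] bilinear_radd[OF bilinear_g[OF u]])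
qed

end

section \<open>Structure equations\<close>

context hyperbolic_immersion
begin

lemma difference_tensor_eq:
  assumes "open W" "W \<subseteq> \<Omega>" "u \<in> W" "smooth_on W Z"
  shows "difference_tensor (-1) y X Z u = C u (X u) (Z u) - christoffel g u (X u) (Z u)"
  using connection_field(2)[OF assms(3,1,2,4)] by (simp add: difference_tensor_def levi_civita_def)

lemma frame_triple_neq_0:
  assumes "u \<in> \<Omega>" "orthonormal_pair (g u) v w"
  shows "triple (dd y u v) (dd y u w) (y u) \<noteq> 0"
proof (rule triple_neq_0[OF linear_dy inj_dy transversal])
  note bl = bilinear_ladd[OF bilinear_g[OF assms(1)]] bilinear_lmul[OF bilinear_g[OF assms(1)]]
    bilinear_lzero[OF bilinear_g[OF assms(1)]]
  fix c d assume *: "c *\<^sub>R v + d *\<^sub>R w = 0"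
  have "g u (c *\<^sub>R v + d *\<^sub>R w) v = c" "g u (c *\<^sub>R v + d *\<^sub>R w) w = d"
    using assms(2) symmetric_g[OF assms(1), of w v] by (simp_all add: bl orthonormal_pair_def)
  then show "c = 0 \<and> d = 0" unfolding * by (simp add: bl)
qed (rule assms(1))+

text \<open>Differentiating the constant products g(E_i, E_j) makes the derivative of the frame
  skew, so a single connection form describes it.\<close>

lemma levi_civita_frame:
  assumes W: "open W" "W \<subseteq> \<Omega>" "u \<in> W" and fr: "orthonormal_frame g W E1 E2"
  shows "levi_civita g (\<lambda>_. v) E1 u = g u (levi_civita g (\<lambda>_. v) E1 u) (E2 u) *\<^sub>R E2 u" (is ?t1)
    and "levi_civita g (\<lambda>_. v) E2 u = - g u (levi_civita g (\<lambda>_. v) E1 u) (E2 u) *\<^sub>R E1 u" (is ?t2)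
proof -
  have u: "u \<in> \<Omega>" using W by blast
  have s: "smooth_on W E1" "smooth_on W E2" and on: "\<And>p. p \<in> W \<Longrightarrow> orthonormal_pair (g p) (E1 p) (E2 p)"
    using fr by (auto simp: orthonormal_frame_def)
  note compat = levi_civita_compat[OF W _ _ on[OF W(3)]]
  have const: "dd (\<lambda>p. g p (X p) (Y p)) u v = 0" if "\<And>p. p \<in> W \<Longrightarrow> g p (X p) (Y p) = c" for X Y c
    using dd_cong[OF W(1,3) that] by simp
  have "dd (\<lambda>p. g p (E1 p) (E1 p)) u v = 0" "dd (\<lambda>p. g p (E2 p) (E2 p)) u v = 0"
    "dd (\<lambda>p. g p (E1 p) (E2 p)) u v = 0"
    using const[of E1 E1 1] const[of E2 E2 1] const[of E1 E2 0] on by (simp_all add: orthonormal_pair_def)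
  then have c: "g u (levi_civita g (\<lambda>_. v) E1 u) (E1 u) = 0" "g u (levi_civita g (\<lambda>_. v) E2 u) (E2 u) = 0"
    "g u (levi_civita g (\<lambda>_. v) E2 u) (E1 u) = - g u (levi_civita g (\<lambda>_. v) E1 u) (E2 u)"
    using compat[OF s(1) s(1), of v] compat[OF s(2) s(2), of v] compat[OF s(1) s(2), of v]
      symmetric_g[OF u, of "E1 u"] symmetric_g[OF u, of "E2 u" "levi_civita g (\<lambda>_. v) E2 u"] by simp_all
  note ex = orthonormal_expansion[OF bilinear_g[OF u] symmetric_g[OF u] on[OF W(3)]]
  show ?t1 using ex[of "levi_civita g (\<lambda>_. v) E1 u"] c by simp
  show ?t2 using ex[of "levi_civita g (\<lambda>_. v) E2 u"] c by simp
qed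

text \<open>The functions a and b are the values of the connection form on E_1 and E_2. The bracket
  is their torsion-free expression, and the last relation is extremality, with T = (f/2)
  E_1.\<close>

lemma frame_structure:
  assumes W: "open W" "W \<subseteq> \<Omega>" and fr: "orthonormal_frame g W E1 E2"
    and K: "\<And>u. u \<in> W \<Longrightarrow> difference_tensor (-1) y E1 E1 u = f u *\<^sub>R E1 u"
      "\<And>u. u \<in> W \<Longrightarrow> difference_tensor (-1) y E1 E2 u = 0"
      "\<And>u. u \<in> W \<Longrightarrow> difference_tensor (-1) y E2 E2 u = 0"
    and ext: "centroaffine_extremal (-1) \<Omega> y"
  obtains a b where "smooth_on W a" "smooth_on W b" "smooth_on W f"
    "\<And>u. u \<in> W \<Longrightarrow> dd (\<lambda>p. dd y p (E1 p)) u (E1 u)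
      = a u *\<^sub>R dd y u (E2 u) + f u *\<^sub>R dd y u (E1 u) + y u"
    "\<And>u. u \<in> W \<Longrightarrow> dd (\<lambda>p. dd y p (E2 p)) u (E1 u) = - a u *\<^sub>R dd y u (E1 u)"
    "\<And>u. u \<in> W \<Longrightarrow> dd (\<lambda>p. dd y p (E1 p)) u (E2 u) = b u *\<^sub>R dd y u (E2 u)"
    "\<And>u. u \<in> W \<Longrightarrow> dd (\<lambda>p. dd y p (E2 p)) u (E2 u) = - b u *\<^sub>R dd y u (E1 u) + y u"
    "\<And>u. u \<in> W \<Longrightarrow> lie_bracket E1 E2 u = - a u *\<^sub>R E1 u - b u *\<^sub>R E2 u"
    "\<And>u. u \<in> W \<Longrightarrow> dd f u (E1 u) + f u * b u = 0"
proof -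
  have sub: "u \<in> \<Omega>" if "u \<in> W" for u using W that by blast
  have s: "smooth_on W E1" "smooth_on W E2" and on: "\<And>p. p \<in> W \<Longrightarrow> orthonormal_pair (g p) (E1 p) (E2 p)"
    using fr by (auto simp: orthonormal_frame_def)
  have sy: "smooth_on W y" by (rule smooth_on_subset[OF smooth_y W(2)])
  define e1 e2 where "e1 = (\<lambda>p. dd y p (E1 p))" and "e2 = (\<lambda>p. dd y p (E2 p))"
  have se: "smooth_on W e1" "smooth_on W e2"
    unfolding e1_def e2_def by (rule smooth_on_dd_field[OF W(1) sy s(1)], rule smooth_on_dd_field[OF W(1) sy s(2)])
  define a b where "a u = g u (levi_civita g (\<lambda>_. E1 u) E1 u) (E2 u)"
    and "b u = g u (levi_civita g (\<lambda>_. E2 u) E1 u) (E2 u)" for u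
  have lc: "levi_civita g E1 E1 u = a u *\<^sub>R E2 u" "levi_civita g E1 E2 u = - a u *\<^sub>R E1 u"
    "levi_civita g E2 E1 u = b u *\<^sub>R E2 u" "levi_civita g E2 E2 u = - b u *\<^sub>R E1 u" if "u \<in> W" for u
    using levi_civita_frame[OF W that fr, of "E1 u"] levi_civita_frame[OF W that fr, of "E2 u"]
    unfolding a_def b_def by (simp_all add: levi_civita_def)
  have conn: "centroaffine_connection (-1) y X Z u = levi_civita g X Z u + difference_tensor (-1) y X Z u"
    for X Z u by (simp add: difference_tensor_def)
  \<comment> \<open>Both connections are torsion free, so K is symmetric and the fourth component
    follows from the second.\<close>
  have K21: "difference_tensor (-1) y E2 E1 u = 0" if "u \<in> W" for u
    using K(2)[OF that] difference_tensor_eq[OF W that s(1)] difference_tensor_eq[OF W that s(2)]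
      symmetric_C[OF sub[OF that]] christoffel_spec(2)[OF sub[OF that] on[OF that]] by metis
  have gE: "g u (E1 u) (E1 u) = 1" "g u (E2 u) (E2 u) = 1" "g u (E1 u) (E2 u) = 0" "g u (E2 u) (E1 u) = 0"
    if "u \<in> W" for u
    using on[OF that] symmetric_g[OF sub[OF that], of "E2 u" "E1 u"] by (auto simp: orthonormal_pair_def)
  have pf: "push_forward y E1 = e1" "push_forward y E2 = e2"
    by (auto simp: push_forward_def e1_def e2_def)
  have D: "dd e1 u (E1 u) = a u *\<^sub>R e2 u + f u *\<^sub>R e1 u + y u"
    "dd e2 u (E1 u) = - a u *\<^sub>R e1 u"
    "dd e1 u (E2 u) = b u *\<^sub>R e2 u"
    "dd e2 u (E2 u) = - b u *\<^sub>R e1 u + y u" if "u \<in> W" for u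
    using connection_field(1)[OF that W s(1), of E1] connection_field(1)[OF that W s(2), of E1]
      connection_field(1)[OF that W s(1), of E2] connection_field(1)[OF that W s(2), of E2]
    unfolding pf conn lc[OF that] K(1,2,3)[OF that] K21[OF that] gE[OF that]
    by (simp_all add: e1_def e2_def linear_add[OF linear_dy[OF sub[OF that]]]
        linear_cmul[OF linear_dy[OF sub[OF that]]] linear_neg[OF linear_dy[OF sub[OF that]]])
  have nz: "triple (e1 u) (e2 u) (y u) \<noteq> 0" if "u \<in> W" for u
    unfolding e1_def e2_def by (rule frame_triple_neq_0[OF sub[OF that] on[OF that]])
  \<comment> \<open>Regularity of a, f and b is read off from the structure equations: replacing one
    column of the determinant of e_1, e_2, y by a derivative isolates the corresponding
    coefficient.\<close>
  have "smooth_on W (\<lambda>u. triple (e1 u) (dd e1 u (E1 u)) (y u) / triple (e1 u) (e2 u) (y u))"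
    by (intro smooth_on_divide smooth_on_triple smooth_on_dd_field se s sy W nz)
  then have sa: "smooth_on W a"
    by (rule smooth_on_cong[OF W(1), rotated]) (use D nz in simp)
  have "smooth_on W (\<lambda>u. triple (dd e1 u (E1 u)) (e2 u) (y u) / triple (e1 u) (e2 u) (y u))"
    by (intro smooth_on_divide smooth_on_triple smooth_on_dd_field se s sy W nz)
  then have sf: "smooth_on W f"
    by (rule smooth_on_cong[OF W(1), rotated]) (use D nz in simp)
  have "smooth_on W (\<lambda>u. triple (e1 u) (dd e1 u (E2 u)) (y u) / triple (e1 u) (e2 u) (y u))"
    by (intro smooth_on_divide smooth_on_triple smooth_on_dd_field se s sy W nz)
  then have sb: "smooth_on W b"
    by (rule smooth_on_cong[OF W(1), rotated]) (use D nz in simp)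
  have lb: "lie_bracket E1 E2 u = - a u *\<^sub>R E1 u - b u *\<^sub>R E2 u" if "u \<in> W" for u
  proof -
    have "lie_bracket E1 E2 u = levi_civita g E1 E2 u - levi_civita g E2 E1 u"
      using christoffel_spec(2)[OF sub[OF that] on[OF that], of "E1 u" "E2 u"]
      by (simp add: lie_bracket_def levi_civita_def)
    then show ?thesis by (simp add: lc[OF that])
  qed
  \<comment> \<open>\<open>metric_trace\<close> asks for a value common to all orthonormal pairs, so
    evaluation on the given frame alone is not enough.\<close>
  have T: "tchebychev (-1) y u = (f u / 2) *\<^sub>R E1 u" if "u \<in> W" for u
  proof -
    note u = sub[OF that]
    define B where "B v w = C u v w - christoffel g u v w" for v w
    have dB: "difference_tensor (-1) y (\<lambda>_. v) (\<lambda>_. w) u = B v w" for v w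
      unfolding B_def by (rule difference_tensor_eq[OF open_dom order_refl u smooth_on_const])
    have bB: "bilinear B"
      using bilinear_C[OF u] christoffel_spec(1)[OF u on[OF that]]
      by (auto simp: B_def bilinear_def linear_compose_sub)
    have B: "B (E1 u) (E1 u) = f u *\<^sub>R E1 u" "B (E1 u) (E2 u) = 0" "B (E2 u) (E1 u) = 0" "B (E2 u) (E2 u) = 0"
      using K(1-3)[OF that] K21[OF that] difference_tensor_eq[OF W that s(1)] difference_tensor_eq[OF W that s(2)]
      by (simp_all add: B_def)
    have tr: "f u *\<^sub>R E1 u = B v v + B w w" if vw: "orthonormal_pair (g u) v w" for v w
    proof -
      have Bz: "B z z = ((g u z (E1 u))\<^sup>2 * f u) *\<^sub>R E1 u" for z
        apply (subst (1 2) orthonormal_expansion[OF bilinear_g[OF u] symmetric_g[OF u] on[OF \<open>u \<in> W\<close>], of z])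
        apply (simp add: bilinear_ladd[OF bB] bilinear_radd[OF bB] bilinear_lmul[OF bB] bilinear_rmul[OF bB] B power2_eq_square)
        done
      \<comment> \<open>Parseval for the unit vector E_1 in the pair (v, w): the two squares
        weighting f E_1 sum to 1.\<close>
      have "g u (E1 u) (E1 u) = (g u (E1 u) v)\<^sup>2 + (g u (E1 u) w)\<^sup>2"
        using arg_cong[OF orthonormal_expansion[OF bilinear_g[OF u] symmetric_g[OF u] vw, of "E1 u"], of "g u (E1 u)"]
        by (simp add: bilinear_radd[OF bilinear_g[OF u]] bilinear_rmul[OF bilinear_g[OF u]] power2_eq_square)
      then have "(g u v (E1 u))\<^sup>2 + (g u w (E1 u))\<^sup>2 = 1"
        using gE(1)[OF \<open>u \<in> W\<close>] symmetric_g[OF u, of "E1 u" v] symmetric_g[OF u, of "E1 u" w] by simp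
      then show ?thesis by (simp add: Bz scaleR_left_distrib[symmetric] distrib_right[symmetric])
    qed
    have "metric_trace (g u) B = f u *\<^sub>R E1 u"
      unfolding metric_trace_def
    proof (rule the_equality)
      show "\<forall>v w. orthonormal_pair (g u) v w \<longrightarrow> f u *\<^sub>R E1 u = B v v + B w w" using tr by blast
      show "t = f u *\<^sub>R E1 u" if "\<forall>v w. orthonormal_pair (g u) v w \<longrightarrow> t = B v v + B w w" for t
        using tr[OF on[OF \<open>u \<in> W\<close>]] that on[OF \<open>u \<in> W\<close>] by metis
    qed
    then show ?thesis by (simp add: tchebychev_def dB)
  qed
  \<comment> \<open>Twice the divergence of (f/2) E_1: the derivative of f along E_1, plus f times
    the E_2-component b of the derivative of E_1 along E_2.\<close>
  have fb: "dd f u (E1 u) + f u * b u = 0" if "u \<in> W" for u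
  proof -
    note u = sub[OF that]
    let ?L = "\<lambda>v. levi_civita g (\<lambda>_. v) (tchebychev (-1) y) u"
    have sT: "smooth_on W (\<lambda>p. (f p / 2) *\<^sub>R E1 p)"
      by (intro smooth_on_scaleR smooth_on_divide W sf smooth_on_const s) simp
    have "dd (tchebychev (-1) y) u v = dd (\<lambda>p. (f p / 2) *\<^sub>R E1 p) u v" for v
      using dd_cong[OF W(1) that T] by simp
    also have "dd (\<lambda>p. (f p / 2) *\<^sub>R E1 p) u v = (f u / 2) *\<^sub>R dd E1 u v + (dd f u v / 2) *\<^sub>R E1 u" for v
      by (rule dd_eqI, rule has_derivative_scaleR)
        (auto intro!: derivative_eq_intros smooth_on_has_derivative[OF sf that] smooth_on_has_derivative[OF s(1) that])
    finally have "?L v = (f u / 2) *\<^sub>R dd E1 u v + (dd f u v / 2) *\<^sub>R E1 u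
        + christoffel g u v ((f u / 2) *\<^sub>R E1 u)" for v
      by (simp add: levi_civita_def T[OF that])
    then have L: "?L v = (f u / 2) *\<^sub>R levi_civita g (\<lambda>_. v) E1 u + (dd f u v / 2) *\<^sub>R E1 u" for v
      using bilinear_rmul[OF christoffel_spec(1)[OF u on[OF that]], of v]
      by (simp add: levi_civita_def algebra_simps)
    have "linear (\<lambda>v. levi_civita g (\<lambda>_. v) E1 u)"
      using linear_compose_add[OF linear_dd[OF s(1) that], of "\<lambda>v. christoffel g u v (E1 u)"]
        christoffel_spec(1)[OF u on[OF that]] by (simp add: levi_civita_def bilinear_def)
    then have "linear ?L"
      using linear_dd[OF sf that] unfolding L linear_iff by (simp add: algebra_simps add_divide_distrib)
    from trace_frame[OF this bilinear_g[OF u] symmetric_g[OF u] on[OF that]]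
    have "g u (?L (E1 u)) (E1 u) + g u (?L (E2 u)) (E2 u) = 0"
      using ext u by (simp add: centroaffine_extremal_def)
    moreover have "levi_civita g (\<lambda>_. E1 u) E1 u = a u *\<^sub>R E2 u" "levi_civita g (\<lambda>_. E2 u) E1 u = b u *\<^sub>R E2 u"
      using lc(1,3)[OF that] by (simp_all add: levi_civita_def)
    ultimately show ?thesis
      unfolding L by (simp add: bilinear_ladd[OF bilinear_g[OF u]] bilinear_lmul[OF bilinear_g[OF u]] gE[OF that])
  qed
  show thesis
    by (rule that[OF sa sb sf D[unfolded e1_def e2_def] lb fb])
qed

end

section \<open>The classification in normal form\<close>

text \<open>If c1, c2, c3 were dependent, a nonzero l would annihilate them and y would stay in the
  plane orthogonal to l. Differentiating at u makes l orthogonal to p, q and y(u), which span R^3.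
  Thus the integration constants are independent without computing their determinant, and B inverts
  the matrix they form.\<close>

lemma columns_invertible:
  fixes W :: "(real^2) set" and y :: "real^2 \<Rightarrow> real^3"
  assumes "open W" "u \<in> W"
    and dy: "(y has_derivative (\<lambda>v. \<sigma> v *\<^sub>R p + \<theta> v *\<^sub>R q)) (at u)"
    and forms: "\<exists>v. \<sigma> v = 1 \<and> \<theta> v = 0" "\<exists>v. \<sigma> v = 0 \<and> \<theta> v = 1"
    and nz: "triple p q (y u) \<noteq> 0"
    and y: "\<And>u. u \<in> W \<Longrightarrow> y u = x1 u *\<^sub>R c1 + x2 u *\<^sub>R c2 + x3 u *\<^sub>R c3"
  shows "\<exists>B :: real^3^3. invertible B \<and> (\<forall>u\<in>W. B *v y u = vector [x1 u, x2 u, x3 u])"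
proof -
  define A :: "real^3^3" where "A = (\<chi> i j. (vector [c1, c2, c3] :: real^3^3) $ j $ i)"
  have A: "A *v z = z $ 1 *\<^sub>R c1 + z $ 2 *\<^sub>R c2 + z $ 3 *\<^sub>R c3" for z
    by (simp add: A_def matrix_vector_mult_def vec_eq_iff sum_3 mult.commute)
  have "invertible A"
  proof (rule ccontr)
    assume "\<not> invertible A"
    then have "\<not> invertible (transpose A)" by (simp add: invertible_det_nz det_transpose)
    then obtain l where l: "l \<noteq> 0" "transpose A *v l = 0"
      unfolding invertible_left_inverse matrix_left_invertible_ker by blast
    have "l \<bullet> (A *v z) = 0" for z
      using l(2) by (metis dot_lmul_matrix inner_zero_left transpose_matrix_vector)
    then have ly: "l \<bullet> y p = 0" if "p \<in> W" for p
      using y[OF that] A[of "vector [x1 p, x2 p, x3 p]"] by (metis vector_3)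
    have d1: "((\<lambda>p. l \<bullet> y p) has_derivative (\<lambda>v. l \<bullet> (\<sigma> v *\<^sub>R p + \<theta> v *\<^sub>R q))) (at u)"
      by (intro has_derivative_inner_right dy)
    have d2: "((\<lambda>p. l \<bullet> y p) has_derivative (\<lambda>v. 0)) (at u)"
      by (rule has_derivative_transform_within_open[OF has_derivative_const[of 0] assms(1,2)])
        (use ly in simp)
    have lv: "l \<bullet> (\<sigma> v *\<^sub>R p + \<theta> v *\<^sub>R q) = 0" for v
      using fun_cong[OF has_derivative_unique[OF d1 d2], of v] .
    have "l \<bullet> p = 0" "l \<bullet> q = 0" "l \<bullet> y u = 0"
      using forms lv ly[OF assms(2)] by (metis add.right_neutral add_0 scale_one scale_zero_left)+
    moreover have "triple p q (y u) * (l \<bullet> l) = triple l q (y u) * (l \<bullet> p) + triple p l (y u) * (l \<bullet> q)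
        + triple p q l * (l \<bullet> y u)"
      using arg_cong[OF triple_expansion[of p q "y u" l], of "inner l"]
      by (simp add: inner_add_right)
    ultimately show False using nz l(1) by simp
  qed
  then obtain B where B: "B ** A = mat 1" "A ** B = mat 1" by (auto simp: invertible_def)
  have "B *v y u = vector [x1 u, x2 u, x3 u]" if "u \<in> W" for u
  proof -
    have "y u = A *v vector [x1 u, x2 u, x3 u]" using y[OF that] by (simp add: A)
    then show ?thesis using B by (simp add: matrix_vector_mul_assoc)
  qed
  moreover have "invertible B" using B by (auto simp: invertible_def)
  ultimately show ?thesis by blast
qed

lemma powr_exp_product:
  fixes z :: real
  assumes "z > 0"
  shows "(z * exp p) powr a * (z * exp q) powr b = exp ((a + b) * ln z + (a * p + b * q))"
proof -
  have "ln (z * exp p) = ln z + p" for p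
    using assms ln_mult[of z "exp p"] by simp
  then show ?thesis
    using assms by (simp add: powr_def exp_add[symmetric] algebra_simps)
qed

lemma add_half_scaleR:
  fixes x z :: "'a::real_vector"
  shows "x + z = (1 / 2) *\<^sub>R x + (z + (1 / 2) *\<^sub>R x)"
proof -
  have "(1 / 2) *\<^sub>R x + (z + (1 / 2) *\<^sub>R x) = (1 / 2 + 1 / 2) *\<^sub>R x + z"
    by (simp only: scaleR_left_distrib add_ac)
  then show ?thesis by simp
qed

text \<open>Packages the five alternatives with their parameter ranges, so that the geometric
  arguments can treat the model as one set \<open>S\<close>.\<close>

definition model_surface :: "(real^3) set \<Rightarrow> bool" where
  "model_surface S \<longleftrightarrow> S = model_log \<or>
    (\<exists>\<alpha>. 0 < \<alpha> \<and> \<alpha> < 1 \<and> S = model_power 1 \<alpha>) \<or>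
    (\<exists>\<alpha>. \<alpha> > 1 \<and> S = model_power (-1) \<alpha>) \<or>
    S = model_exp \<or>
    (\<exists>\<alpha>. \<alpha> < 0 \<and> S = model_arctan \<alpha>)"

text \<open>In coordinates \<open>(s, t)\<close> with \<open>\<sigma> = ds\<close> and \<open>\<theta> = dt\<close>, the metric is \<open>\<rho>\<^sup>2 ds\<^sup>2 + dt\<^sup>2\<close> with
  \<open>\<rho>\<close> depending on \<open>t\<close> only, \<open>\<tau> = \<rho>'\<close> and \<open>\<rho>'' = \<rho>\<close>. The coordinate \<open>t\<close> itself is not needed.\<close>

locale normal_form =
  fixes W :: "(real^2) set" and y e1 e2 :: "real^2 \<Rightarrow> real^3" and \<rho> \<tau> s :: "real^2 \<Rightarrow> real"
    and \<sigma> \<theta> :: "real^2 \<Rightarrow> real^2 \<Rightarrow> real"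
  assumes open_W: "open W" and convex_W: "convex W"
    and dy: "\<And>u. u \<in> W \<Longrightarrow> (y has_derivative (\<lambda>v. \<sigma> u v *\<^sub>R (\<rho> u *\<^sub>R e1 u) + \<theta> u v *\<^sub>R e2 u)) (at u)"
    and de1: "\<And>u. u \<in> W \<Longrightarrow>
      (e1 has_derivative (\<lambda>v. \<sigma> u v *\<^sub>R (e1 u + (\<rho> u *\<^sub>R y u - \<tau> u *\<^sub>R e2 u)))) (at u)"
    and de2: "\<And>u. u \<in> W \<Longrightarrow> (e2 has_derivative (\<lambda>v. \<sigma> u v *\<^sub>R (\<tau> u *\<^sub>R e1 u) + \<theta> u v *\<^sub>R y u)) (at u)"
    and d\<rho>: "\<And>u. u \<in> W \<Longrightarrow> (\<rho> has_derivative (\<lambda>v. \<theta> u v * \<tau> u)) (at u)"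
    and d\<tau>: "\<And>u. u \<in> W \<Longrightarrow> (\<tau> has_derivative (\<lambda>v. \<theta> u v * \<rho> u)) (at u)"
    and ds: "\<And>u. u \<in> W \<Longrightarrow> (s has_derivative (\<lambda>v. \<sigma> u v)) (at u)"
    and \<rho>_pos: "\<And>u. u \<in> W \<Longrightarrow> \<rho> u > 0"
    and forms: "\<And>u. u \<in> W \<Longrightarrow> \<exists>v. \<sigma> u v = 1 \<and> \<theta> u v = 0" "\<And>u. u \<in> W \<Longrightarrow> \<exists>v. \<sigma> u v = 0 \<and> \<theta> u v = 1"
    and nz: "\<And>u. u \<in> W \<Longrightarrow> triple (e1 u) (e2 u) (y u) \<noteq> 0"
begin

text \<open>The only use of convexity: every constant of integration below is obtained from
  it.\<close>

lemma constantI: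
  fixes F :: "real^2 \<Rightarrow> 'b::banach"
  assumes "\<And>u. u \<in> W \<Longrightarrow> (F has_derivative (\<lambda>v. 0)) (at u)"
  shows "\<exists>c. \<forall>u\<in>W. F u = c"
  by (rule has_derivative_zero_constant[OF convex_W]) (use assms has_derivative_at_withinI in blast)

text \<open>Reduces each case to writing y with constant vectors and checking the model equation for
  the coefficients. The set \<open>V\<close> may be smaller than \<open>W\<close>, as the arctangent
  case requires.\<close>

lemma coordinates:
  assumes "open V" "V \<subseteq> W" "u0 \<in> V"
    and "\<And>u. u \<in> V \<Longrightarrow> y u = x1 u *\<^sub>R c1 + x2 u *\<^sub>R c2 + x3 u *\<^sub>R c3"
    and "\<And>u. u \<in> V \<Longrightarrow> vector [x1 u, x2 u, x3 u] \<in> S"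
  shows "\<exists>B :: real^3^3. invertible B \<and> (\<forall>u\<in>V. B *v y u \<in> S)"
proof -
  have u0: "u0 \<in> W" using assms by blast
  have "triple (\<rho> u0 *\<^sub>R e1 u0) (e2 u0) (y u0) \<noteq> 0"
    using nz[OF u0] \<rho>_pos[OF u0] by simp
  from columns_invertible[OF assms(1,3) dy[OF u0] forms[OF u0] this assms(4)] assms(5)
  show ?thesis by metis
qed

abbreviation "c u \<equiv> \<rho> u *\<^sub>R y u - \<tau> u *\<^sub>R e2 u"

lemma const_k: "\<exists>k. \<forall>u\<in>W. (\<rho> u)\<^sup>2 - (\<tau> u)\<^sup>2 = k"
  by (rule constantI) (auto intro!: derivative_eq_intros d\<rho> d\<tau> simp: algebra_simps)

lemma const_N: "\<exists>N. \<forall>u\<in>W. \<rho> u *\<^sub>R e2 u - \<tau> u *\<^sub>R y u = N"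
  by (rule constantI) (auto intro!: derivative_eq_intros d\<rho> d\<tau> de2 dy simp: algebra_simps)

lemma dc:
  assumes "u \<in> W" "(\<rho> u)\<^sup>2 - (\<tau> u)\<^sup>2 = k"
  shows "(c has_derivative (\<lambda>v. (\<sigma> u v * k) *\<^sub>R e1 u)) (at u)"
  unfolding assms(2)[symmetric]
  using assms(1) by (auto intro!: derivative_eq_intros d\<rho> d\<tau> de2 dy simp: algebra_simps power2_eq_square)

text \<open>Along s, (c + r e_1)' = k e_1 + r (e_1 + c) = r (c + r e_1) exactly when r^2 = r + k.
  Multiplying by exp(-r s) gives a constant vector.\<close>

lemma eigenvector:
  assumes k: "\<And>u. u \<in> W \<Longrightarrow> (\<rho> u)\<^sup>2 - (\<tau> u)\<^sup>2 = k" and r: "r * r = r + k"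
  shows "\<exists>p. \<forall>u\<in>W. c u + r *\<^sub>R e1 u = exp (r * s u) *\<^sub>R p"
proof -
  have "\<exists>p. \<forall>u\<in>W. exp (- r * s u) *\<^sub>R (c u + r *\<^sub>R e1 u) = p"
  proof (rule constantI)
    fix u assume u: "u \<in> W"
    have "((\<lambda>u. c u + r *\<^sub>R e1 u) has_derivative
        (\<lambda>v. (\<sigma> u v * k) *\<^sub>R e1 u + r *\<^sub>R (\<sigma> u v *\<^sub>R (e1 u + c u)))) (at u)"
      by (intro has_derivative_add has_derivative_scaleR_right dc[OF u k[OF u]] de1[OF u])
    also have "(\<lambda>v. (\<sigma> u v * k) *\<^sub>R e1 u + r *\<^sub>R (\<sigma> u v *\<^sub>R (e1 u + c u)))
        = (\<lambda>v. (r * \<sigma> u v) *\<^sub>R (c u + r *\<^sub>R e1 u))"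
    proof
      fix v
      have "(\<sigma> u v * k) *\<^sub>R e1 u + r *\<^sub>R (\<sigma> u v *\<^sub>R (e1 u + c u))
          = (\<sigma> u v * (r + k)) *\<^sub>R e1 u + (r * \<sigma> u v) *\<^sub>R c u"
        by (simp only: scaleR_right_distrib scaleR_scaleR) (simp add: algebra_simps)
      then show "(\<sigma> u v * k) *\<^sub>R e1 u + r *\<^sub>R (\<sigma> u v *\<^sub>R (e1 u + c u)) = (r * \<sigma> u v) *\<^sub>R (c u + r *\<^sub>R e1 u)"
        by (simp add: r[symmetric] scaleR_right_distrib mult_ac)
    qed
    finally have d: "((\<lambda>u. c u + r *\<^sub>R e1 u) has_derivative (\<lambda>v. (r * \<sigma> u v) *\<^sub>R (c u + r *\<^sub>R e1 u))) (at u)" .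
    have "((\<lambda>u. exp (- r * s u)) has_derivative (\<lambda>v. exp (- r * s u) * (- r * \<sigma> u v))) (at u)"
      using ds[OF u] by (auto intro!: derivative_eq_intros)
    from has_derivative_scaleR[OF this d]
    show "((\<lambda>u. exp (- r * s u) *\<^sub>R (c u + r *\<^sub>R e1 u)) has_derivative (\<lambda>v. 0)) (at u)"
      by (rule has_derivative_eq_rhs)
        (simp add: fun_eq_iff scaleR_scaleR[symmetric] del: scaleR_scaleR)
  qed
  then obtain p where p: "\<And>u. u \<in> W \<Longrightarrow> exp (- r * s u) *\<^sub>R (c u + r *\<^sub>R e1 u) = p" by blast
  have "c u + r *\<^sub>R e1 u = exp (r * s u) *\<^sub>R p" if "u \<in> W" for u
    unfolding p[OF that, symmetric] by (simp add: exp_add[symmetric])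
  then show ?thesis by blast
qed

text \<open>The pair (c, N) arises from (y, e_2) by a matrix of determinant \<rho>^2 - \<tau>^2 = k;
  this is the inverse relation.\<close>

lemma y_decomposition:
  assumes "(\<rho> u)\<^sup>2 - (\<tau> u)\<^sup>2 = k" "k \<noteq> 0" "\<rho> u *\<^sub>R e2 u - \<tau> u *\<^sub>R y u = N"
  shows "y u = (\<rho> u / k) *\<^sub>R c u + (\<tau> u / k) *\<^sub>R N"
proof -
  have "k *\<^sub>R y u = \<rho> u *\<^sub>R c u + \<tau> u *\<^sub>R N"
    unfolding assms(1,3)[symmetric] by (simp add: algebra_simps power2_eq_square)
  then have "(1 / k) *\<^sub>R k *\<^sub>R y u = (1 / k) *\<^sub>R (\<rho> u *\<^sub>R c u + \<tau> u *\<^sub>R N)" by simp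
  then show ?thesis using assms(2) by (simp add: scaleR_right_distrib)
qed

section \<open>The five cases according to the characteristic roots\<close>

text \<open>Two distinct real roots r1 and r2 give two exponential solutions, from which c is
  obtained by eliminating e_1. Both signs of k are treated at once; \<open>sgn k\<close> is the
  right-hand side of the model equation.\<close>

lemma case_real:
  assumes k: "\<And>u. u \<in> W \<Longrightarrow> (\<rho> u)\<^sup>2 - (\<tau> u)\<^sup>2 = k" "k \<noteq> 0" "1 + 4 * k > 0" and "u0 \<in> W"
  shows "\<exists>B :: real^3^3. invertible B \<and> (\<forall>u\<in>W. B *v y u \<in> model_power (sgn k) (1 / sqrt (1 + 4 * k)))"
proof -
  \<comment> \<open>Square root of the discriminant of r^2 - r - k, hence the difference of the two
    roots.\<close>
  define \<delta> where "\<delta> = sqrt (1 + 4 * k)"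
  have \<delta>: "\<delta> > 0" "\<delta>\<^sup>2 = 1 + 4 * k" using k(3) by (simp_all add: \<delta>_def)
  define r1 r2 where "r1 = (1 + \<delta>) / 2" and "r2 = (1 - \<delta>) / 2"
  have "r1 * r1 = r1 + k" "r2 * r2 = r2 + k"
    using \<delta>(2) by (simp_all add: r1_def r2_def power2_eq_square field_simps)
  then obtain c1 c2 where c1: "\<And>u. u \<in> W \<Longrightarrow> c u + r1 *\<^sub>R e1 u = exp (r1 * s u) *\<^sub>R c1"
    and c2: "\<And>u. u \<in> W \<Longrightarrow> c u + r2 *\<^sub>R e1 u = exp (r2 * s u) *\<^sub>R c2"
    using eigenvector[OF k(1)] by metis
  obtain N where N: "\<And>u. u \<in> W \<Longrightarrow> \<rho> u *\<^sub>R e2 u - \<tau> u *\<^sub>R y u = N" using const_N by blast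
  \<comment> \<open>Dividing by m normalises \<rho>^2 - \<tau>^2 = k to
    \<open>sgn k\<close>.\<close>
  define m where "m = sqrt \<bar>k\<bar>"
  have m: "m > 0" "m\<^sup>2 = \<bar>k\<bar>" using k(2) by (simp_all add: m_def)
  define z where "z u = \<rho> u / m" for u
  show ?thesis
  proof (rule coordinates[OF open_W order_refl \<open>u0 \<in> W\<close>])
    fix u assume u: "u \<in> W"
    have "\<delta> *\<^sub>R c u = r1 *\<^sub>R (c u + r2 *\<^sub>R e1 u) - r2 *\<^sub>R (c u + r1 *\<^sub>R e1 u)"
    proof -
      have "r1 *\<^sub>R (c u + r2 *\<^sub>R e1 u) - r2 *\<^sub>R (c u + r1 *\<^sub>R e1 u) = (r1 - r2) *\<^sub>R c u"
        by (simp add: scaleR_right_distrib scaleR_left_diff_distrib mult.commute[of r1])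
      then show ?thesis by (simp add: r1_def r2_def diff_divide_distrib[symmetric])
    qed
    then have "\<delta> *\<^sub>R c u = (r1 * exp (r2 * s u)) *\<^sub>R c2 - (r2 * exp (r1 * s u)) *\<^sub>R c1"
      unfolding c1[OF u] c2[OF u] by simp
    then have "(1 / \<delta>) *\<^sub>R \<delta> *\<^sub>R c u = (1 / \<delta>) *\<^sub>R ((r1 * exp (r2 * s u)) *\<^sub>R c2 - (r2 * exp (r1 * s u)) *\<^sub>R c1)"
      by simp
    then have c: "c u = (r1 * exp (r2 * s u) / \<delta>) *\<^sub>R c2 - (r2 * exp (r1 * s u) / \<delta>) *\<^sub>R c1"
      using \<delta>(1) by (simp add: scaleR_right_diff_distrib)
    show "y u = (\<tau> u / m) *\<^sub>R ((m / k) *\<^sub>R N) + (z u * exp (r1 * s u)) *\<^sub>R ((- (m * r2 / (k * \<delta>))) *\<^sub>R c1)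
        + (z u * exp (r2 * s u)) *\<^sub>R ((m * r1 / (k * \<delta>)) *\<^sub>R c2)"
    proof -
      have coef: "\<tau> u / m * (m / k) = \<tau> u / k"
        "z u * exp (r1 * s u) * (- (m * r2 / (k * \<delta>))) = - (\<rho> u / k * (r2 * exp (r1 * s u) / \<delta>))"
        "z u * exp (r2 * s u) * (m * r1 / (k * \<delta>)) = \<rho> u / k * (r1 * exp (r2 * s u) / \<delta>)"
        using m(1) by (simp_all add: z_def)
      show ?thesis
        using y_decomposition[OF k(1)[OF u] k(2) N[OF u]] unfolding c scaleR_scaleR coef
        by (simp add: scaleR_right_diff_distrib)
    qed
  next
    fix u assume u: "u \<in> W"
    have z: "z u > 0" using \<rho>_pos[OF u] m(1) by (simp add: z_def)
    \<comment> \<open>Since r1 + r2 = 1 and r1 - r2 = \<delta>, these weights cancel s; as the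
      weights sum to 2, only z^2 survives.\<close>
    have "(1 - 1 / \<delta>) * (r1 * s u) + (1 + 1 / \<delta>) * (r2 * s u) = 0"
      using \<delta>(1) by (simp add: r1_def r2_def field_simps)
    then have "(z u * exp (r1 * s u)) powr (1 - 1 / \<delta>) * (z u * exp (r2 * s u)) powr (1 + 1 / \<delta>)
        = exp (2 * ln (z u))"
      unfolding powr_exp_product[OF z] by simp
    also have "\<dots> = (z u)\<^sup>2" using z by (metis exp_ln exp_of_nat_mult of_nat_numeral)
    finally have "(z u * exp (r1 * s u)) powr (1 - 1 / \<delta>) * (z u * exp (r2 * s u)) powr (1 + 1 / \<delta>)
        - (\<tau> u / m)\<^sup>2 = sgn k"
      using k(1)[OF u] m k(2) by (simp add: z_def power_divide diff_divide_distrib[symmetric] sgn_if abs_if)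
    with z show "vector [\<tau> u / m, z u * exp (r1 * s u), z u * exp (r2 * s u)] \<in> model_power (sgn k) (1 / sqrt (1 + 4 * k))"
      by (simp add: model_power_def \<delta>_def[symmetric])
  qed
qed

text \<open>At the double root 1/2 there is one eigenvector p, and the second solution carries a
  factor s: exp(-s/2) e_1 has derivative p. The quotient of the first two coordinates is then s
  itself, and the factor 2 in the coordinates normalises k = -1/4.\<close>

lemma case_double:
  assumes k: "\<And>u. u \<in> W \<Longrightarrow> (\<rho> u)\<^sup>2 - (\<tau> u)\<^sup>2 = - (1 / 4)" and "u0 \<in> W"
  shows "\<exists>B :: real^3^3. invertible B \<and> (\<forall>u\<in>W. B *v y u \<in> model_exp)"
proof -
  obtain p where p: "\<And>u. u \<in> W \<Longrightarrow> c u + (1 / 2) *\<^sub>R e1 u = exp (1 / 2 * s u) *\<^sub>R p"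
    using eigenvector[OF k, of "1 / 2"] by auto
  have "\<exists>d. \<forall>u\<in>W. exp (- (s u / 2)) *\<^sub>R e1 u - s u *\<^sub>R p = d"
  proof (rule constantI)
    fix u assume u: "u \<in> W"
    have e: "e1 u + c u = (1 / 2) *\<^sub>R e1 u + exp (s u / 2) *\<^sub>R p"
      using add_half_scaleR[of "e1 u" "c u"] p[OF u] by simp
    have "((\<lambda>u. exp (- (s u / 2)) *\<^sub>R e1 u - s u *\<^sub>R p) has_derivative
        (\<lambda>v. exp (- (s u / 2)) *\<^sub>R (\<sigma> u v *\<^sub>R (e1 u + c u)) + (exp (- (s u / 2)) * (- (\<sigma> u v / 2))) *\<^sub>R e1 u
          - \<sigma> u v *\<^sub>R p)) (at u)"
      using ds[OF u] de1[OF u] by (auto intro!: derivative_eq_intros)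
    then show "((\<lambda>u. exp (- (s u / 2)) *\<^sub>R e1 u - s u *\<^sub>R p) has_derivative (\<lambda>v. 0)) (at u)"
      by (rule has_derivative_eq_rhs)
        (simp add: e fun_eq_iff scaleR_right_distrib exp_add[symmetric] mult.commute mult.left_commute)
  qed
  then obtain d where d: "\<And>u. u \<in> W \<Longrightarrow> exp (- (s u / 2)) *\<^sub>R e1 u - s u *\<^sub>R p = d" by blast
  obtain N where N: "\<And>u. u \<in> W \<Longrightarrow> \<rho> u *\<^sub>R e2 u - \<tau> u *\<^sub>R y u = N" using const_N by blast
  show ?thesis
  proof (rule coordinates[OF open_W order_refl \<open>u0 \<in> W\<close>])
    fix u assume u: "u \<in> W"
    have "e1 u = exp (s u / 2) *\<^sub>R (exp (- (s u / 2)) *\<^sub>R e1 u)" by (simp add: exp_add[symmetric])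
    also have "exp (- (s u / 2)) *\<^sub>R e1 u = d + s u *\<^sub>R p" using d[OF u] by (simp add: algebra_simps)
    finally have e1: "e1 u = exp (s u / 2) *\<^sub>R (d + s u *\<^sub>R p)" .
    have c: "c u = exp (s u / 2) *\<^sub>R p - (1 / 2) *\<^sub>R e1 u" using p[OF u] by (simp add: algebra_simps)
    show "y u = (2 * \<rho> u * exp (s u / 2)) *\<^sub>R (d - 2 *\<^sub>R p) + (2 * \<rho> u * exp (s u / 2) * s u) *\<^sub>R p
        + (2 * \<tau> u) *\<^sub>R ((- 2) *\<^sub>R N)"
      using y_decomposition[OF k[OF u] _ N[OF u]] unfolding c e1 by (simp add: algebra_simps)
  next
    fix u assume u: "u \<in> W"
    have "(exp (s u / 2))\<^sup>2 * exp (- s u) = 1"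
      by (simp add: power2_eq_square exp_add[symmetric])
    then have "(2 * \<tau> u)\<^sup>2 - (2 * \<rho> u * exp (s u / 2))\<^sup>2 * exp (- s u) = 4 * (\<tau> u)\<^sup>2 - 4 * (\<rho> u)\<^sup>2"
      by (simp add: power_mult_distrib)
    also have "\<dots> = 1" using k[OF u] by simp
    finally show "vector [2 * \<rho> u * exp (s u / 2), 2 * \<rho> u * exp (s u / 2) * s u, 2 * \<tau> u] \<in> model_exp"
      using \<rho>_pos[OF u] by (simp add: model_exp_def)
  qed
qed

text \<open>The roots are 1/2 + i \<omega> and 1/2 - i \<omega>. Removing the growth exp(t/2) leaves
  a harmonic oscillator, so the first two coordinates are polar with angle \<omega> t.\<close>

lemma case_complex:
  assumes k: "\<And>u. u \<in> W \<Longrightarrow> (\<rho> u)\<^sup>2 - (\<tau> u)\<^sup>2 = k" "1 + 4 * k < 0" and u0: "u0 \<in> W"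
  shows "\<exists>V (B :: real^3^3). open V \<and> V \<subseteq> W \<and> u0 \<in> V \<and> invertible B
    \<and> (\<forall>u\<in>V. B *v y u \<in> model_arctan (- 2 / sqrt (- (1 + 4 * k))))"
proof -
  define \<omega> where "\<omega> = sqrt (- (1 + 4 * k)) / 2"
  have \<omega>: "\<omega> > 0" "\<omega>\<^sup>2 = - (1 / 4) - k" using k(2) by (simp_all add: \<omega>_def power_divide)
  \<comment> \<open>The system is autonomous in s, so the parameter may be shifted; the angle is
    then 0 at \<open>u0\<close>, inside the range of the arctangent.\<close>
  define t where "t u = s u - s u0" for u
  have dt: "(t has_derivative \<sigma> u) (at u)" if "u \<in> W" for u
    unfolding t_def using ds[OF that] by (auto intro!: derivative_eq_intros)
  \<comment> \<open>The combination with q' = q/2 - \<omega>^2 e_1 and e_1' = e_1/2 + q, which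
    displays the real part 1/2 and the frequency \<omega>.\<close>
  define q where "q u = c u + (1 / 2) *\<^sub>R e1 u" for u
  have de: "(e1 has_derivative (\<lambda>v. \<sigma> u v *\<^sub>R ((1 / 2) *\<^sub>R e1 u + q u))) (at u)" if "u \<in> W" for u
  proof -
    have "e1 u + c u = (1 / 2) *\<^sub>R e1 u + q u"
      unfolding q_def by (rule add_half_scaleR)
    with de1[OF that] show ?thesis by simp
  qed
  have dq: "(q has_derivative (\<lambda>v. \<sigma> u v *\<^sub>R ((1 / 2) *\<^sub>R q u - \<omega>\<^sup>2 *\<^sub>R e1 u))) (at u)" if "u \<in> W" for u
  proof -
    have "(q has_derivative (\<lambda>v. (\<sigma> u v * k) *\<^sub>R e1 u + (1 / 2) *\<^sub>R (\<sigma> u v *\<^sub>R ((1 / 2) *\<^sub>R e1 u + q u)))) (at u)"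
      unfolding q_def[abs_def]
      by (intro has_derivative_add has_derivative_scaleR_right dc[OF that k(1)[OF that]] de[OF that, unfolded q_def])
    then show ?thesis
      by (rule has_derivative_eq_rhs) (simp add: \<omega>(2) fun_eq_iff algebra_simps)
  qed
  have dexp: "((\<lambda>u. exp (- (t u / 2))) has_derivative (\<lambda>v. exp (- (t u / 2)) * (- (\<sigma> u v / 2)))) (at u)"
    if "u \<in> W" for u
    using dt[OF that] by (auto intro!: derivative_eq_intros)
  define p1 where "p1 u = exp (- (t u / 2)) *\<^sub>R e1 u" for u
  define p2 where "p2 u = exp (- (t u / 2)) *\<^sub>R q u" for u
  have dp1: "(p1 has_derivative (\<lambda>v. \<sigma> u v *\<^sub>R p2 u)) (at u)" if "u \<in> W" for u
    unfolding p1_def[abs_def]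
    by (rule has_derivative_eq_rhs[OF has_derivative_scaleR[OF dexp[OF that] de[OF that]]])
      (simp add: fun_eq_iff p2_def algebra_simps)
  have dp2: "(p2 has_derivative (\<lambda>v. \<sigma> u v *\<^sub>R (- (\<omega>\<^sup>2) *\<^sub>R p1 u))) (at u)" if "u \<in> W" for u
    unfolding p2_def[abs_def]
    by (rule has_derivative_eq_rhs[OF has_derivative_scaleR[OF dexp[OF that] dq[OF that]]])
      (simp add: fun_eq_iff p1_def algebra_simps)
  have dcos: "((\<lambda>u. cos (\<omega> * t u)) has_derivative (\<lambda>v. - sin (\<omega> * t u) * (\<omega> * \<sigma> u v))) (at u)"
    and dsin: "((\<lambda>u. sin (\<omega> * t u)) has_derivative (\<lambda>v. cos (\<omega> * t u) * (\<omega> * \<sigma> u v))) (at u)"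
    if "u \<in> W" for u
    using dt[OF that] by (auto intro!: derivative_eq_intros)
  \<comment> \<open>The pair (p1, p2/\<omega>) rotates through the angle \<omega> t; rotating it
    back yields the two constants c1 and c2.\<close>
  have "\<exists>c1. \<forall>u\<in>W. cos (\<omega> * t u) *\<^sub>R p1 u - sin (\<omega> * t u) *\<^sub>R ((1 / \<omega>) *\<^sub>R p2 u) = c1"
  proof (rule constantI)
    fix u assume u: "u \<in> W"
    show "((\<lambda>u. cos (\<omega> * t u) *\<^sub>R p1 u - sin (\<omega> * t u) *\<^sub>R ((1 / \<omega>) *\<^sub>R p2 u)) has_derivative (\<lambda>v. 0)) (at u)"
      by (rule has_derivative_eq_rhs[OF has_derivative_diff[OF has_derivative_scaleR[OF dcos[OF u] dp1[OF u]]
              has_derivative_scaleR[OF dsin[OF u] has_derivative_scaleR_right[OF dp2[OF u]]]]])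
        (use \<omega>(1) in \<open>simp add: fun_eq_iff algebra_simps power2_eq_square\<close>)
  qed
  then obtain c1 where c1: "\<And>u. u \<in> W \<Longrightarrow> cos (\<omega> * t u) *\<^sub>R p1 u - sin (\<omega> * t u) *\<^sub>R ((1 / \<omega>) *\<^sub>R p2 u) = c1"
    by blast
  have "\<exists>c2. \<forall>u\<in>W. sin (\<omega> * t u) *\<^sub>R p1 u + cos (\<omega> * t u) *\<^sub>R ((1 / \<omega>) *\<^sub>R p2 u) = c2"
  proof (rule constantI)
    fix u assume u: "u \<in> W"
    show "((\<lambda>u. sin (\<omega> * t u) *\<^sub>R p1 u + cos (\<omega> * t u) *\<^sub>R ((1 / \<omega>) *\<^sub>R p2 u)) has_derivative (\<lambda>v. 0)) (at u)"
      by (rule has_derivative_eq_rhs[OF has_derivative_add[OF has_derivative_scaleR[OF dsin[OF u] dp1[OF u]]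
              has_derivative_scaleR[OF dcos[OF u] has_derivative_scaleR_right[OF dp2[OF u]]]]])
        (use \<omega>(1) in \<open>simp add: fun_eq_iff algebra_simps power2_eq_square\<close>)
  qed
  then obtain c2 where c2: "\<And>u. u \<in> W \<Longrightarrow> sin (\<omega> * t u) *\<^sub>R p1 u + cos (\<omega> * t u) *\<^sub>R ((1 / \<omega>) *\<^sub>R p2 u) = c2"
    by blast
  obtain N where N: "\<And>u. u \<in> W \<Longrightarrow> \<rho> u *\<^sub>R e2 u - \<tau> u *\<^sub>R y u = N" using const_N by blast
  have rot: "Y = C *\<^sub>R (C *\<^sub>R Y - S *\<^sub>R Z) + S *\<^sub>R (S *\<^sub>R Y + C *\<^sub>R Z)"
    "Z = C *\<^sub>R (S *\<^sub>R Y + C *\<^sub>R Z) - S *\<^sub>R (C *\<^sub>R Y - S *\<^sub>R Z)"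
    if "C * C + S * S = 1" for C S :: real and Y Z :: "real^3"
    using that by (simp_all add: scaleR_right_distrib scaleR_right_diff_distrib mult.commute[of C S]
        add.commute scaleR_left_distrib[symmetric])
  have cs: "cos x * cos x + sin x * sin x = 1" for x :: real
    using sin_cos_squared_add[of x] by (simp add: power2_eq_square)
  \<comment> \<open>On this neighbourhood the angle lies in the principal branch, and the first
    coordinate, a positive multiple of its cosine, does not vanish.\<close>
  define V where "V = {u \<in> W. \<bar>\<omega> * t u\<bar> < pi / 2}"
  have "continuous_on W t"
    using dt has_derivative_continuous continuous_at_imp_continuous_on by blast
  then have "continuous_on W (\<lambda>u. \<bar>\<omega> * t u\<bar>)" by (intro continuous_intros)
  then have "open (W \<inter> (\<lambda>u. \<bar>\<omega> * t u\<bar>) -` {..<pi / 2})"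
    by (rule continuous_open_preimage) (use open_W in auto)
  then have "open V" by (simp add: V_def vimage_def Int_def)
  have "V \<subseteq> W" by (auto simp: V_def)
  have "u0 \<in> V" using u0 by (simp add: V_def t_def)
  define m where "m = sqrt (- k)"
  have m: "m > 0" "m\<^sup>2 = - k" using k(2) by (simp_all add: m_def)
  define x where "x u = \<rho> u / m * exp (t u / 2)" for u
  have "\<exists>B :: real^3^3. invertible B \<and> (\<forall>u\<in>V. B *v y u \<in> model_arctan (- 2 / sqrt (- (1 + 4 * k))))"
  proof (rule coordinates[OF \<open>open V\<close> \<open>V \<subseteq> W\<close> \<open>u0 \<in> V\<close>])
    fix u assume "u \<in> V"
    then have u: "u \<in> W" by (simp add: V_def)
    have P: "p1 u = cos (\<omega> * t u) *\<^sub>R c1 + sin (\<omega> * t u) *\<^sub>R c2"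
      "(1 / \<omega>) *\<^sub>R p2 u = cos (\<omega> * t u) *\<^sub>R c2 - sin (\<omega> * t u) *\<^sub>R c1"
      using rot[OF cs[of "\<omega> * t u"], where Y = "p1 u" and Z = "(1 / \<omega>) *\<^sub>R p2 u"] unfolding c1[OF u] c2[OF u] by blast+
    have "p2 u = \<omega> *\<^sub>R ((1 / \<omega>) *\<^sub>R p2 u)" using \<omega>(1) by simp
    then have P2: "p2 u = \<omega> *\<^sub>R (cos (\<omega> * t u) *\<^sub>R c2 - sin (\<omega> * t u) *\<^sub>R c1)" unfolding P .
    have "c u = q u - (1 / 2) *\<^sub>R e1 u" by (simp add: q_def)
    also have "\<dots> = exp (t u / 2) *\<^sub>R (p2 u - (1 / 2) *\<^sub>R p1 u)"
      by (simp add: p1_def p2_def scaleR_right_diff_distrib exp_add[symmetric] mult.left_commute)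
    finally have c: "c u = exp (t u / 2) *\<^sub>R (p2 u - (1 / 2) *\<^sub>R p1 u)" .
    show "y u = (x u * cos (\<omega> * t u)) *\<^sub>R ((m / k) *\<^sub>R (\<omega> *\<^sub>R c2 - (1 / 2) *\<^sub>R c1))
        + (x u * sin (\<omega> * t u)) *\<^sub>R ((m / k) *\<^sub>R (- \<omega> *\<^sub>R c1 - (1 / 2) *\<^sub>R c2)) + (\<tau> u / m) *\<^sub>R ((m / k) *\<^sub>R N)"
      using y_decomposition[OF k(1)[OF u] _ N[OF u]] k(2) m(1)
      unfolding c P2 P(1) x_def by (simp add: algebra_simps)
  next
    fix u assume V: "u \<in> V"
    then have u: "u \<in> W" by (simp add: V_def)
    have x: "x u > 0" using \<rho>_pos[OF u] m(1) by (simp add: x_def)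
    have range: "- (pi / 2) < \<omega> * t u" "\<omega> * t u < pi / 2" using V by (auto simp: V_def)
    have cos: "cos (\<omega> * t u) > 0" by (rule cos_gt_zero_pi[OF range])
    have "x u * sin (\<omega> * t u) / (x u * cos (\<omega> * t u)) = tan (\<omega> * t u)" using x by (simp add: tan_def)
    then have at: "arctan (x u * sin (\<omega> * t u) / (x u * cos (\<omega> * t u))) = \<omega> * t u"
      using arctan_tan[OF range] by simp
    have "(x u * cos (\<omega> * t u))\<^sup>2 + (x u * sin (\<omega> * t u))\<^sup>2 = (x u)\<^sup>2"
      by (simp add: power_mult_distrib distrib_left[symmetric])
    then have "(x u * cos (\<omega> * t u))\<^sup>2 + (x u * sin (\<omega> * t u))\<^sup>2 = (\<rho> u / m)\<^sup>2 * exp (t u)"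
      by (simp add: x_def power_mult_distrib power_divide exp_double[symmetric])
    \<comment> \<open>The parameter is -1/\<omega>, so the exponential in the model equation is
      exp(-t) and cancels the growth of the squared radius.\<close>
    moreover have "- 2 / sqrt (- (1 + 4 * k)) * (\<omega> * t u) = - t u"
    proof -
      have "sqrt (- (1 + 4 * k)) = 2 * \<omega>" by (simp add: \<omega>_def)
      then show ?thesis using \<omega>(1) by simp
    qed
    ultimately have "(\<tau> u / m)\<^sup>2 - ((x u * cos (\<omega> * t u))\<^sup>2 + (x u * sin (\<omega> * t u))\<^sup>2)
        * exp (- 2 / sqrt (- (1 + 4 * k)) * (\<omega> * t u)) = (\<tau> u / m)\<^sup>2 - (\<rho> u / m)\<^sup>2"
      by (simp add: mult.assoc exp_add[symmetric])
    also have "\<dots> = ((\<tau> u)\<^sup>2 - (\<rho> u)\<^sup>2) / m\<^sup>2" by (simp add: power_divide diff_divide_distrib)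
    also have "\<dots> = 1"
    proof -
      have "(\<tau> u)\<^sup>2 - (\<rho> u)\<^sup>2 = m\<^sup>2" using k(1)[OF u] m(2) by simp
      then show ?thesis using m(1) by simp
    qed
    finally show "vector [x u * cos (\<omega> * t u), x u * sin (\<omega> * t u), \<tau> u / m]
        \<in> model_arctan (- 2 / sqrt (- (1 + 4 * k)))"
      unfolding model_arctan_def mem_Collect_eq vector_3 at using x cos by simp
  qed
  then show ?thesis using \<open>open V\<close> \<open>V \<subseteq> W\<close> \<open>u0 \<in> V\<close> by blast
qed

text \<open>For k = 0 the vectors c and N are proportional, so y cannot be recovered from them. The
  quotient -\<tau>/\<rho> is a constant sign a, the roots are 0 and 1, and y/\<rho> is integrated
  directly.\<close>

lemma case_log:
  assumes k: "\<And>u. u \<in> W \<Longrightarrow> (\<rho> u)\<^sup>2 - (\<tau> u)\<^sup>2 = 0" and u0: "u0 \<in> W"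
  shows "\<exists>B :: real^3^3. invertible B \<and> (\<forall>u\<in>W. B *v y u \<in> model_log)"
proof -
  have "\<exists>a. \<forall>u\<in>W. - (\<tau> u / \<rho> u) = a"
  proof (rule constantI)
    fix u assume u: "u \<in> W"
    show "((\<lambda>u. - (\<tau> u / \<rho> u)) has_derivative (\<lambda>v. 0)) (at u)"
      by (rule has_derivative_eq_rhs[OF has_derivative_minus[OF has_derivative_divide'[OF d\<tau>[OF u] d\<rho>[OF u]]]])
        (use k[OF u] \<rho>_pos[OF u] in \<open>simp_all add: fun_eq_iff power2_eq_square\<close>)
  qed
  then obtain a where a: "\<And>u. u \<in> W \<Longrightarrow> - (\<tau> u / \<rho> u) = a" by blast
  have \<tau>: "\<tau> u = - a * \<rho> u" if "u \<in> W" for u using a[OF that] \<rho>_pos[OF that] by (simp add: field_simps)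
  have aa: "a * a = 1"
  proof -
    have "(1 - a * a) * (\<rho> u0)\<^sup>2 = 0"
      using k[OF u0] \<tau>[OF u0] by (simp add: power2_eq_square algebra_simps)
    then show ?thesis using \<rho>_pos[OF u0] by simp
  qed
  obtain N where N: "\<And>u. u \<in> W \<Longrightarrow> \<rho> u *\<^sub>R e2 u - \<tau> u *\<^sub>R y u = N" using const_N by blast
  have c: "c u = a *\<^sub>R N" if "u \<in> W" for u
  proof -
    have "a *\<^sub>R N = (a * a * \<rho> u) *\<^sub>R y u + (a * \<rho> u) *\<^sub>R e2 u"
      unfolding N[OF that, symmetric] \<tau>[OF that] by (simp add: algebra_simps)
    then show ?thesis by (simp add: aa \<tau>[OF that])
  qed
  obtain p where p: "\<And>u. u \<in> W \<Longrightarrow> c u + 1 *\<^sub>R e1 u = exp (1 * s u) *\<^sub>R p"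
    using eigenvector[OF k, of 1] by auto
  have e1: "e1 u = exp (s u) *\<^sub>R p - a *\<^sub>R N" if "u \<in> W" for u
    using p[OF that] c[OF that] by (simp add: algebra_simps)
  \<comment> \<open>Substituting e_1 = exp(s) p - a N and e_2 = N/\<rho> - a y gives d(y/\<rho>) =
    \<sigma> (exp(s) p - a N) + \<theta> N/\<rho>^2. The subtracted terms are primitives of the two
    parts; a^2 = 1 enters in the one with 1/\<rho>^2.\<close>
  have "\<exists>c0. \<forall>u\<in>W. (1 / \<rho> u) *\<^sub>R y u - (a / 2 / (\<rho> u)\<^sup>2) *\<^sub>R N - exp (s u) *\<^sub>R p + (a * s u) *\<^sub>R N = c0"
  proof (rule constantI)
    fix u assume u: "u \<in> W"
    note \<rho> = \<rho>_pos[OF u]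
    have e2: "e2 u = (1 / \<rho> u) *\<^sub>R N - a *\<^sub>R y u"
    proof -
      have "e2 u = (1 / \<rho> u) *\<^sub>R (\<rho> u *\<^sub>R e2 u - \<tau> u *\<^sub>R y u) - a *\<^sub>R y u"
        using \<rho> \<tau>[OF u] by (simp add: scaleR_right_distrib)
      then show ?thesis unfolding N[OF u] .
    qed
    have d1: "((\<lambda>u. 1 / \<rho> u) has_derivative (\<lambda>v. \<theta> u v * (a / \<rho> u))) (at u)"
      by (rule has_derivative_eq_rhs[OF has_derivative_divide'[OF has_derivative_const d\<rho>[OF u]]])
        (use \<rho> \<tau>[OF u] in \<open>simp_all add: fun_eq_iff\<close>)
    have d2: "((\<lambda>u. a / 2 / (\<rho> u)\<^sup>2) has_derivative (\<lambda>v. \<theta> u v * (1 / (\<rho> u)\<^sup>2))) (at u)"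
    proof -
      have "((\<lambda>u. a / 2 * ((1 / \<rho> u) * (1 / \<rho> u))) has_derivative
          (\<lambda>v. a / 2 * ((1 / \<rho> u) * (\<theta> u v * (a / \<rho> u)) + \<theta> u v * (a / \<rho> u) * (1 / \<rho> u)))) (at u)"
        by (intro has_derivative_mult_right has_derivative_mult d1)
      then have "((\<lambda>u. a / 2 * ((1 / \<rho> u) * (1 / \<rho> u))) has_derivative (\<lambda>v. \<theta> u v * (1 / (\<rho> u)\<^sup>2))) (at u)"
        by (rule has_derivative_eq_rhs) (use aa \<rho> in \<open>simp add: fun_eq_iff power2_eq_square field_simps\<close>)
      then show ?thesis by (simp add: power2_eq_square)
    qed
    have d3: "((\<lambda>u. exp (s u)) has_derivative (\<lambda>v. exp (s u) * \<sigma> u v)) (at u)"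
      "((\<lambda>u. a * s u) has_derivative (\<lambda>v. a * \<sigma> u v)) (at u)"
      using ds[OF u] by (auto intro!: derivative_eq_intros)
    have "((\<lambda>u. (1 / \<rho> u) *\<^sub>R y u - (a / 2 / (\<rho> u)\<^sup>2) *\<^sub>R N - exp (s u) *\<^sub>R p + (a * s u) *\<^sub>R N) has_derivative
        (\<lambda>v. (1 / \<rho> u) *\<^sub>R (\<sigma> u v *\<^sub>R (\<rho> u *\<^sub>R e1 u) + \<theta> u v *\<^sub>R e2 u) + (\<theta> u v * (a / \<rho> u)) *\<^sub>R y u
          - (\<theta> u v * (1 / (\<rho> u)\<^sup>2)) *\<^sub>R N - (exp (s u) * \<sigma> u v) *\<^sub>R p + (a * \<sigma> u v) *\<^sub>R N)) (at u)"
      by (intro has_derivative_add has_derivative_diff has_derivative_scaleR has_derivative_scaleR_left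
          d1 d2 d3 dy[OF u])
    then show "((\<lambda>u. (1 / \<rho> u) *\<^sub>R y u - (a / 2 / (\<rho> u)\<^sup>2) *\<^sub>R N - exp (s u) *\<^sub>R p + (a * s u) *\<^sub>R N)
        has_derivative (\<lambda>v. 0)) (at u)"
      by (rule has_derivative_eq_rhs)
        (use \<rho> in \<open>simp add: fun_eq_iff e1[OF u] e2 scaleR_right_distrib scaleR_right_diff_distrib
          power2_eq_square mult_ac\<close>)
  qed
  then obtain c0 where c0: "\<And>u. u \<in> W \<Longrightarrow>
    (1 / \<rho> u) *\<^sub>R y u - (a / 2 / (\<rho> u)\<^sup>2) *\<^sub>R N - exp (s u) *\<^sub>R p + (a * s u) *\<^sub>R N = c0" by blast
  \<comment> \<open>Scaling by l matches the coefficients of 1/\<rho> and \<rho> s with the model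
    equation, which requires 2/l = l.\<close>
  define l where "l = sqrt (2 :: real)"
  have l: "l > 0" "l * l = 2" by (simp_all add: l_def)
  show ?thesis
  proof (rule coordinates[OF open_W order_refl u0])
    fix u assume u: "u \<in> W"
    note \<rho> = \<rho>_pos[OF u]
    have "(1 / \<rho> u) *\<^sub>R y u = c0 + exp (s u) *\<^sub>R p + (a / 2 / (\<rho> u)\<^sup>2 - a * s u) *\<^sub>R N"
      using c0[OF u] by (simp add: algebra_simps)
    then have "\<rho> u *\<^sub>R ((1 / \<rho> u) *\<^sub>R y u) = \<rho> u *\<^sub>R (c0 + exp (s u) *\<^sub>R p + (a / 2 / (\<rho> u)\<^sup>2 - a * s u) *\<^sub>R N)"
      by simp
    then have "y u = \<rho> u *\<^sub>R (c0 + exp (s u) *\<^sub>R p + (a / 2 / (\<rho> u)\<^sup>2 - a * s u) *\<^sub>R N)"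
      using \<rho> by simp
    also have "\<dots> = \<rho> u *\<^sub>R c0 + (\<rho> u * exp (s u)) *\<^sub>R p + (a / 2 * (1 / \<rho> u - 2 * \<rho> u * s u)) *\<^sub>R N"
      using \<rho> by (simp add: scaleR_right_distrib power2_eq_square right_diff_distrib mult_ac)
    also have "\<dots> = (l * \<rho> u) *\<^sub>R ((1 / l) *\<^sub>R c0) + (l * \<rho> u * exp (s u)) *\<^sub>R ((1 / l) *\<^sub>R p)
        + (1 / l * (1 / \<rho> u - 2 * \<rho> u * s u)) *\<^sub>R ((a * l / 2) *\<^sub>R N)"
      using l(1) by (simp add: mult_ac)
    finally show "y u = (l * \<rho> u) *\<^sub>R ((1 / l) *\<^sub>R c0) + (l * \<rho> u * exp (s u)) *\<^sub>R ((1 / l) *\<^sub>R p)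
        + (1 / l * (1 / \<rho> u - 2 * \<rho> u * s u)) *\<^sub>R ((a * l / 2) *\<^sub>R N)" .
  next
    fix u assume u: "u \<in> W"
    note \<rho> = \<rho>_pos[OF u]
    have "ln (l * \<rho> u) - ln (l * \<rho> u * exp (s u)) = - s u"
      using \<rho> l(1) by (simp add: ln_mult)
    moreover have "1 / l * (2 * \<rho> u * s u) = l * \<rho> u * s u" using l by (simp add: field_simps)
    ultimately have "1 / l * (1 / \<rho> u - 2 * \<rho> u * s u)
        = 1 / (l * \<rho> u) + l * \<rho> u * (ln (l * \<rho> u) - ln (l * \<rho> u * exp (s u)))"
      by (simp add: right_diff_distrib)
    then show "vector [l * \<rho> u, l * \<rho> u * exp (s u), 1 / l * (1 / \<rho> u - 2 * \<rho> u * s u)] \<in> model_log"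
      using \<rho> l(1) by (simp add: model_log_def)
  qed
qed

lemma classification:
  assumes u0: "u0 \<in> W"
  shows "\<exists>V S (B :: real^3^3).
    (open V \<and> V \<subseteq> W \<and> u0 \<in> V \<and> invertible B \<and> (\<forall>u\<in>V. B *v y u \<in> S)) \<and>
    model_surface S"
    (is "\<exists>V S B. ?P V S B \<and> _")
proof -
  obtain k where k: "\<And>u. u \<in> W \<Longrightarrow> (\<rho> u)\<^sup>2 - (\<tau> u)\<^sup>2 = k" using const_k by blast
  have *: "\<exists>V S B. ?P V S B \<and> model_surface S"
    if "\<exists>B :: real^3^3. invertible B \<and> (\<forall>u\<in>W. B *v y u \<in> S)" "model_surface S" for S
    using that open_W u0 by blast
  \<comment> \<open>The value k = 0 also has real distinct roots; it is separated because
    \<open>y_decomposition\<close> divides by k.\<close>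
  consider "k = 0" | "k > 0" | "k < 0" "1 + 4 * k > 0" | "k = - (1 / 4)" | "1 + 4 * k < 0" by linarith
  then show ?thesis
  proof cases
    case 1
    then show ?thesis using k by (intro *[OF case_log[OF _ u0]]) (auto simp: model_surface_def)
  next
    case 2
    then have "sqrt (1 + 4 * k) > 1" by simp
    then have "0 < 1 / sqrt (1 + 4 * k)" "1 / sqrt (1 + 4 * k) < 1" by simp_all
    moreover have "\<exists>B :: real^3^3. invertible B \<and> (\<forall>u\<in>W. B *v y u \<in> model_power 1 (1 / sqrt (1 + 4 * k)))"
      using case_real[OF k _ _ u0] 2 by simp
    ultimately show ?thesis by (intro *[of "model_power 1 (1 / sqrt (1 + 4 * k))"]) (unfold model_surface_def, blast+)
  next
    case 3
    then have "sqrt (1 + 4 * k) > 0" "sqrt (1 + 4 * k) < 1" by simp_all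
    then have "1 / sqrt (1 + 4 * k) > 1" by simp
    moreover have "\<exists>B :: real^3^3. invertible B \<and> (\<forall>u\<in>W. B *v y u \<in> model_power (-1) (1 / sqrt (1 + 4 * k)))"
      using case_real[OF k _ _ u0] 3 by simp
    ultimately show ?thesis by (intro *[of "model_power (-1) (1 / sqrt (1 + 4 * k))"]) (unfold model_surface_def, blast+)
  next
    case 4
    then show ?thesis using k by (intro *[OF case_double[OF _ u0]]) (auto simp: model_surface_def)
  next
    case 5
    then have "- 2 / sqrt (- (1 + 4 * k)) < 0" by (simp add: divide_neg_pos)
    with case_complex[OF k 5 u0] show ?thesis unfolding model_surface_def by blast
  qed
qed

end

section \<open>Integrability\<close>

context hyperbolic_immersion
begin

text \<open>Commuting derivatives of e_1 and e_2 and comparing coefficients in the basis e_1, e_2, y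
  yields the Gauss and Codazzi equations. Commuting derivatives of f afterwards yields the last
  relation for a.\<close>

lemma frame_integrability:
  assumes W: "open W" "W \<subseteq> \<Omega>" and fr: "orthonormal_frame g W E1 E2"
    and K: "\<And>u. u \<in> W \<Longrightarrow> difference_tensor (-1) y E1 E1 u = f u *\<^sub>R E1 u"
      "\<And>u. u \<in> W \<Longrightarrow> difference_tensor (-1) y E1 E2 u = 0"
      "\<And>u. u \<in> W \<Longrightarrow> difference_tensor (-1) y E2 E2 u = 0"
    and f: "\<And>u. u \<in> W \<Longrightarrow> f u > 0"
    and extr: "centroaffine_extremal (-1) \<Omega> y"
  obtains a where "smooth_on W a" "smooth_on W f"
    "\<And>u. u \<in> W \<Longrightarrow> dd (\<lambda>p. dd y p (E1 p)) u (E1 u)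
      = a u *\<^sub>R dd y u (E2 u) + f u *\<^sub>R dd y u (E1 u) + y u"
    "\<And>u. u \<in> W \<Longrightarrow> dd (\<lambda>p. dd y p (E2 p)) u (E1 u) = - a u *\<^sub>R dd y u (E1 u)"
    "\<And>u. u \<in> W \<Longrightarrow> dd (\<lambda>p. dd y p (E1 p)) u (E2 u) = 0"
    "\<And>u. u \<in> W \<Longrightarrow> dd (\<lambda>p. dd y p (E2 p)) u (E2 u) = y u"
    "\<And>u. u \<in> W \<Longrightarrow> dd f u (E1 u) = 0" "\<And>u. u \<in> W \<Longrightarrow> dd f u (E2 u) = a u * f u"
    "\<And>u. u \<in> W \<Longrightarrow> dd a u (E1 u) = 0" "\<And>u. u \<in> W \<Longrightarrow> dd a u (E2 u) = (a u)\<^sup>2 - 1"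
proof -
  have sub: "u \<in> \<Omega>" if "u \<in> W" for u using W that by blast
  have s: "smooth_on W E1" "smooth_on W E2" and on: "\<And>p. p \<in> W \<Longrightarrow> orthonormal_pair (g p) (E1 p) (E2 p)"
    using fr by (auto simp: orthonormal_frame_def)
  have sy: "smooth_on W y" by (rule smooth_on_subset[OF smooth_y W(2)])
  define e1 e2 where "e1 = (\<lambda>p. dd y p (E1 p))" and "e2 = (\<lambda>p. dd y p (E2 p))"
  have se: "smooth_on W e1" "smooth_on W e2"
    unfolding e1_def e2_def by (rule smooth_on_dd_field[OF W(1) sy s(1)], rule smooth_on_dd_field[OF W(1) sy s(2)])
  have e: "dd y u (E1 u) = e1 u" "dd y u (E2 u) = e2 u" for u by (simp_all add: e1_def e2_def)
  obtain a b where ab: "smooth_on W a" "smooth_on W b" "smooth_on W f"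
    and D: "\<And>u. u \<in> W \<Longrightarrow> dd e1 u (E1 u) = a u *\<^sub>R e2 u + f u *\<^sub>R e1 u + y u"
      "\<And>u. u \<in> W \<Longrightarrow> dd e2 u (E1 u) = - a u *\<^sub>R e1 u"
      "\<And>u. u \<in> W \<Longrightarrow> dd e1 u (E2 u) = b u *\<^sub>R e2 u"
      "\<And>u. u \<in> W \<Longrightarrow> dd e2 u (E2 u) = - b u *\<^sub>R e1 u + y u"
    and lb: "\<And>u. u \<in> W \<Longrightarrow> lie_bracket E1 E2 u = - a u *\<^sub>R E1 u - b u *\<^sub>R E2 u"
    and fb: "\<And>u. u \<in> W \<Longrightarrow> dd f u (E1 u) + f u * b u = 0"
    using frame_structure[OF W fr K extr] unfolding e1_def e2_def by blast
  have nz: "triple (e1 u) (e2 u) (y u) \<noteq> 0" if "u \<in> W" for u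
    unfolding e1_def e2_def by (rule frame_triple_neq_0[OF sub[OF that] on[OF that]])
  \<comment> \<open>The commutator formula with the first derivatives of h already replaced by their
    known values: F along E_2 and G along E_1.\<close>
  have comm: "dd F u v - dd G u w = - a u *\<^sub>R dd h u (E1 u) - b u *\<^sub>R dd h u (E2 u)"
    if "u \<in> W" "smooth_on W h" "\<And>p. p \<in> W \<Longrightarrow> dd h p (E2 p) = F p" "\<And>p. p \<in> W \<Longrightarrow> dd h p (E1 p) = G p"
      "v = E1 u" "w = E2 u" for h F G :: "real^2 \<Rightarrow> 'z::euclidean_space" and u v w
  proof -
    have "dd F u = dd (\<lambda>p. dd h p (E2 p)) u" "dd G u = dd (\<lambda>p. dd h p (E1 p)) u"
      using dd_cong[OF W(1) that(1), of F "\<lambda>p. dd h p (E2 p)"]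
        dd_cong[OF W(1) that(1), of G "\<lambda>p. dd h p (E1 p)"] that(3,4) by simp_all
    then show ?thesis
      using dd_commutator[OF W(1) that(1,2) s] lb[OF that(1)] linear_dd[OF that(2,1)]
      by (simp add: that(5,6) linear_diff linear_cmul linear_neg)
  qed
  note der = smooth_on_has_derivative
  have main: "dd f u (E2 u) = a u * f u \<and> b u = 0 \<and> dd b u (E1 u) = dd a u (E2 u) + 1 - (a u)\<^sup>2" if u: "u \<in> W" for u
  proof -
    define d where "d = triple (e1 u) (e2 u) (y u)"
    have d: "d \<noteq> 0" "triple (e1 u) (e2 u) (y u) = d" using nz[OF u] by (simp_all add: d_def)
    have "dd (\<lambda>p. b p *\<^sub>R e2 p) u v = b u *\<^sub>R dd e2 u v + dd b u v *\<^sub>R e2 u" for v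
      by (rule dd_eqI[OF has_derivative_scaleR[OF der[OF ab(2) u] der[OF se(2) u]]])
    moreover have "dd (\<lambda>p. a p *\<^sub>R e2 p + f p *\<^sub>R e1 p + y p) u v = a u *\<^sub>R dd e2 u v + dd a u v *\<^sub>R e2 u
        + (f u *\<^sub>R dd e1 u v + dd f u v *\<^sub>R e1 u) + dd y u v" for v
      by (rule dd_eqI[OF has_derivative_add[OF has_derivative_add[OF
            has_derivative_scaleR[OF der[OF ab(1) u] der[OF se(2) u]]
            has_derivative_scaleR[OF der[OF ab(3) u] der[OF se(1) u]]] der[OF sy u]]])
    ultimately have 1: "b u *\<^sub>R (- a u *\<^sub>R e1 u) + dd b u (E1 u) *\<^sub>R e2 u
        - (a u *\<^sub>R (- b u *\<^sub>R e1 u + y u) + dd a u (E2 u) *\<^sub>R e2 u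
          + (f u *\<^sub>R b u *\<^sub>R e2 u + dd f u (E2 u) *\<^sub>R e1 u) + e2 u)
      = - a u *\<^sub>R (a u *\<^sub>R e2 u + f u *\<^sub>R e1 u + y u) - b u *\<^sub>R b u *\<^sub>R e2 u"
      using comm[OF u se(1) D(3,1) refl refl] by (simp only: D[OF u] e)
    have "dd (\<lambda>p. - b p *\<^sub>R e1 p + y p) u v = - b u *\<^sub>R dd e1 u v + - dd b u v *\<^sub>R e1 u + dd y u v" for v
      by (rule dd_eqI[OF has_derivative_add[OF
            has_derivative_scaleR[OF has_derivative_minus[OF der[OF ab(2) u]] der[OF se(1) u]] der[OF sy u]]])
    moreover have "dd (\<lambda>p. - a p *\<^sub>R e1 p) u v = - a u *\<^sub>R dd e1 u v + - dd a u v *\<^sub>R e1 u" for v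
      by (rule dd_eqI[OF has_derivative_scaleR[OF has_derivative_minus[OF der[OF ab(1) u]] der[OF se(1) u]]])
    ultimately have 2: "- b u *\<^sub>R (a u *\<^sub>R e2 u + f u *\<^sub>R e1 u + y u) + - dd b u (E1 u) *\<^sub>R e1 u + e1 u
        - (- a u *\<^sub>R b u *\<^sub>R e2 u + - dd a u (E2 u) *\<^sub>R e1 u)
      = - a u *\<^sub>R - a u *\<^sub>R e1 u - b u *\<^sub>R (- b u *\<^sub>R e1 u + y u)"
      using comm[OF u se(2) D(4,2) refl refl] by (simp only: D[OF u] e)
    \<comment> \<open>Inserting both sides as one column of the determinant isolates a single
      coefficient; the nonzero factor d is then cancelled.\<close>
    have "- dd f u (E2 u) * d = - (a u * f u) * d"
      using arg_cong[OF 1, of "\<lambda>z. triple z (e2 u) (y u)"] by (simp add: d(2) algebra_simps)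
    then have f2: "dd f u (E2 u) = a u * f u" using d(1) by simp
    have "(dd b u (E1 u) - dd a u (E2 u) - f u * b u - 1) * d = (- (a u)\<^sup>2 - (b u)\<^sup>2) * d"
      using arg_cong[OF 1, of "\<lambda>z. triple (e1 u) z (y u)"] by (simp add: d(2) algebra_simps power2_eq_square)
    moreover have "(- b u * f u - dd b u (E1 u) + 1 + dd a u (E2 u)) * d = ((a u)\<^sup>2 + (b u)\<^sup>2) * d"
      using arg_cong[OF 2, of "\<lambda>z. triple z (e2 u) (y u)"] by (simp add: d(2) algebra_simps power2_eq_square)
    ultimately have "dd b u (E1 u) - dd a u (E2 u) - f u * b u - 1 = - (a u)\<^sup>2 - (b u)\<^sup>2"
      "- b u * f u - dd b u (E1 u) + 1 + dd a u (E2 u) = (a u)\<^sup>2 + (b u)\<^sup>2"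
      using d(1) mult_right_cancel by blast+
    \<comment> \<open>Adding the two relations leaves -2 f b = 0. Once b = 0, either of them is the
      equation for a.\<close>
    moreover from this have "f u * b u = 0" by algebra
    then have "b u = 0" using f[OF u] by simp
    ultimately show ?thesis using f2 by simp
  qed
  \<comment> \<open>b vanishes on the whole open set, so its derivative vanishes as well and D_2 a =
    a^2 - 1 remains.\<close>
  have b: "b u = 0" "dd b u = (\<lambda>_. 0)" if "u \<in> W" for u
    using main[OF that] dd_cong[OF W(1) that, of b "\<lambda>_. 0"] main by simp_all
  have f1: "dd f u (E1 u) = 0" if "u \<in> W" for u using fb[OF that] b[OF that] by simp
  have a2: "dd a u (E2 u) = (a u)\<^sup>2 - 1" if "u \<in> W" for u using main[OF that] b[OF that] by simp
  \<comment> \<open>The commutator is applied to f: since D_1 f = 0, D_2 f = a f and b = 0, it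
    reduces to f D_1 a = 0.\<close>
  have a1: "dd a u (E1 u) = 0" if u: "u \<in> W" for u
  proof -
    have "dd (\<lambda>p. a p * f p) u v = a u * dd f u v + dd a u v * f u" for v
      by (rule dd_eqI[OF has_derivative_mult[OF der[OF ab(1) u] der[OF ab(3) u]]])
    then show ?thesis
      using comm[OF u ab(3), of "\<lambda>p. a p * f p" "\<lambda>p. 0" "E1 u" "E2 u"] main f1 b[OF u] f[OF u] u by simp
  qed
  show thesis
    by (rule that[OF ab(1,3)]) (use D main f1 a1 a2 b in \<open>simp_all add: e1_def e2_def\<close>)
qed

section \<open>From the adapted frame to the normal form\<close>

lemma local_model:
  assumes W: "open W" "W \<subseteq> \<Omega>" and fr: "orthonormal_frame g W E1 E2"
    and K: "\<And>u. u \<in> W \<Longrightarrow> difference_tensor (-1) y E1 E1 u = f u *\<^sub>R E1 u"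
      "\<And>u. u \<in> W \<Longrightarrow> difference_tensor (-1) y E1 E2 u = 0"
      "\<And>u. u \<in> W \<Longrightarrow> difference_tensor (-1) y E2 E2 u = 0"
    and f: "\<And>u. u \<in> W \<Longrightarrow> f u > 0"
    and extr: "centroaffine_extremal (-1) \<Omega> y"
    and u0: "u0 \<in> W"
  shows "\<exists>V S (B :: real^3^3).
    (open V \<and> V \<subseteq> W \<and> u0 \<in> V \<and> invertible B \<and> (\<forall>u\<in>V. B *v y u \<in> S)) \<and>
    model_surface S"
proof -
  have sub: "u \<in> \<Omega>" if "u \<in> W" for u using W that by blast
  have s: "smooth_on W E1" "smooth_on W E2" and on: "\<And>p. p \<in> W \<Longrightarrow> orthonormal_pair (g p) (E1 p) (E2 p)"
    using fr by (auto simp: orthonormal_frame_def)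
  have sy: "smooth_on W y" by (rule smooth_on_subset[OF smooth_y W(2)])
  define e1 e2 where "e1 = (\<lambda>p. dd y p (E1 p))" and "e2 = (\<lambda>p. dd y p (E2 p))"
  have se: "smooth_on W e1" "smooth_on W e2"
    unfolding e1_def e2_def by (rule smooth_on_dd_field[OF W(1) sy s(1)], rule smooth_on_dd_field[OF W(1) sy s(2)])
  have e: "dd y u (E1 u) = e1 u" "dd y u (E2 u) = e2 u" for u by (simp_all add: e1_def e2_def)
  obtain a where a: "smooth_on W a" and sf: "smooth_on W f"
    and D: "\<And>u. u \<in> W \<Longrightarrow> dd e1 u (E1 u) = a u *\<^sub>R e2 u + f u *\<^sub>R e1 u + y u"
      "\<And>u. u \<in> W \<Longrightarrow> dd e2 u (E1 u) = - a u *\<^sub>R e1 u"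
      "\<And>u. u \<in> W \<Longrightarrow> dd e1 u (E2 u) = 0"
      "\<And>u. u \<in> W \<Longrightarrow> dd e2 u (E2 u) = y u"
      "\<And>u. u \<in> W \<Longrightarrow> dd f u (E1 u) = 0" "\<And>u. u \<in> W \<Longrightarrow> dd f u (E2 u) = a u * f u"
      "\<And>u. u \<in> W \<Longrightarrow> dd a u (E1 u) = 0" "\<And>u. u \<in> W \<Longrightarrow> dd a u (E2 u) = (a u)\<^sup>2 - 1"
    using frame_integrability[OF W fr K f extr] unfolding e1_def e2_def by blast
  have nz: "triple (e1 u) (e2 u) (y u) \<noteq> 0" if "u \<in> W" for u
    unfolding e1_def e2_def by (rule frame_triple_neq_0[OF sub[OF that] on[OF that]])
  define \<theta>1 \<theta>2 where "\<theta>1 u v = g u v (E1 u)" and "\<theta>2 u v = g u v (E2 u)" for u v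
  \<comment> \<open>The forms \<theta>1 and \<theta>2 are the dual coframe, so a differential is
    determined by its values on E_1 and E_2.\<close>
  have split: "(h has_derivative (\<lambda>v. \<theta>1 u v *\<^sub>R dd h u (E1 u) + \<theta>2 u v *\<^sub>R dd h u (E2 u))) (at u)"
    if "u \<in> W" "smooth_on W h" for u and h :: "real^2 \<Rightarrow> 'z::real_normed_vector"
  proof (rule has_derivative_eq_rhs[OF smooth_on_has_derivative[OF that(2,1)]], rule ext)
    fix v
    have "v = \<theta>1 u v *\<^sub>R E1 u + \<theta>2 u v *\<^sub>R E2 u"
      unfolding \<theta>1_def \<theta>2_def
      by (rule orthonormal_expansion[OF bilinear_g[OF sub[OF that(1)]] symmetric_g[OF sub[OF that(1)]] on[OF that(1)]])
    then have "dd h u v = dd h u (\<theta>1 u v *\<^sub>R E1 u + \<theta>2 u v *\<^sub>R E2 u)" by simp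
    then show "dd h u v = \<theta>1 u v *\<^sub>R dd h u (E1 u) + \<theta>2 u v *\<^sub>R dd h u (E2 u)"
      using linear_dd[OF that(2,1)] by (simp add: linear_add linear_cmul)
  qed
  define \<rho> \<tau> where "\<rho> u = 1 / f u" and "\<tau> u = - (a u / f u)" for u
  define \<sigma> where "\<sigma> u v = f u * \<theta>1 u v" for u v
  \<comment> \<open>Half the logarithm of the square is ln of the absolute value of the determinant;
    it is differentiable for either orientation.\<close>
  define s where "s u = ln ((triple (e1 u) (e2 u) (y u))\<^sup>2) / 2" for u
  \<comment> \<open>The normal form asks for a convex domain.\<close>
  obtain r where r: "r > 0" "ball u0 r \<subseteq> W" using W(1) u0 open_contains_ball by blast
  interpret normal_form "ball u0 r" y e1 e2 \<rho> \<tau> s \<sigma> \<theta>2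
  proof
    fix u assume "u \<in> ball u0 r"
    then have u: "u \<in> W" using r by blast
    note fu = f[OF u]
    have \<rho>\<sigma>: "\<sigma> u v * \<rho> u = \<theta>1 u v" "\<sigma> u v * \<tau> u = - (\<theta>1 u v * a u)" for v
      using fu by (simp_all add: \<sigma>_def \<rho>_def \<tau>_def)
    show "(y has_derivative (\<lambda>v. \<sigma> u v *\<^sub>R \<rho> u *\<^sub>R e1 u + \<theta>2 u v *\<^sub>R e2 u)) (at u)"
      using split[OF u sy] by (simp add: e \<rho>\<sigma>)
    show "(e1 has_derivative (\<lambda>v. \<sigma> u v *\<^sub>R (e1 u + (\<rho> u *\<^sub>R y u - \<tau> u *\<^sub>R e2 u)))) (at u)"
      by (rule has_derivative_eq_rhs[OF split[OF u se(1)]])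
        (simp add: fun_eq_iff D[OF u] scaleR_right_distrib scaleR_right_diff_distrib \<rho>\<sigma>,
          simp add: \<sigma>_def ac_simps)
    show "(e2 has_derivative (\<lambda>v. \<sigma> u v *\<^sub>R \<tau> u *\<^sub>R e1 u + \<theta>2 u v *\<^sub>R y u)) (at u)"
      using split[OF u se(2)] by (simp add: D[OF u] \<rho>\<sigma>)
    have df: "(f has_derivative (\<lambda>v. \<theta>2 u v * (a u * f u))) (at u)"
      and da: "(a has_derivative (\<lambda>v. \<theta>2 u v * ((a u)\<^sup>2 - 1))) (at u)"
      using split[OF u sf] split[OF u a] by (simp_all add: D[OF u])
    show "(\<rho> has_derivative (\<lambda>v. \<theta>2 u v * \<tau> u)) (at u)"
      unfolding \<rho>_def[abs_def]
      by (rule has_derivative_eq_rhs[OF has_derivative_divide'[OF has_derivative_const df]])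
        (use fu in \<open>simp_all add: fun_eq_iff \<tau>_def\<close>)
    show "(\<tau> has_derivative (\<lambda>v. \<theta>2 u v * \<rho> u)) (at u)"
      unfolding \<tau>_def[abs_def]
      by (rule has_derivative_eq_rhs[OF has_derivative_minus[OF has_derivative_divide'[OF da df]]])
        (use fu in \<open>simp_all add: fun_eq_iff \<rho>_def field_simps power2_eq_square\<close>)
    show "(s has_derivative \<sigma> u) (at u)"
    proof -
      let ?d = "\<lambda>u. triple (e1 u) (e2 u) (y u)"
      have cross: "bounded_bilinear cross3" using bilinear_cross bilinear_conv_bounded_bilinear by blast
      have "(?d has_derivative (\<lambda>v. e1 u \<bullet> (cross3 (e2 u) (dd y u v) + cross3 (dd e2 u v) (y u))
          + dd e1 u v \<bullet> cross3 (e2 u) (y u))) (at u)"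
        unfolding triple_def
        by (intro has_derivative_inner bounded_bilinear.FDERIV[OF cross] smooth_on_has_derivative[OF _ u] sy se)
      then have dd: "dd ?d u v = triple (e1 u) (e2 u) (dd y u v) + triple (e1 u) (dd e2 u v) (y u)
          + triple (dd e1 u v) (e2 u) (y u)" for v
        by (subst dd_eqI) (auto simp: triple_def inner_add_right)
      have "smooth_on W ?d" by (rule smooth_on_triple[OF W(1) se sy])
      \<comment> \<open>The logarithmic derivative of the determinant is the sum of the diagonal
        coefficients of the structure equations: f along E_1 and 0 along E_2.\<close>
      from split[OF u this] have "(?d has_derivative (\<lambda>v. \<sigma> u v * ?d u)) (at u)"
        by (simp add: dd D[OF u] e \<sigma>_def ac_simps)
      from has_derivative_mult[OF this this]
      have "((\<lambda>u. (?d u)\<^sup>2) has_derivative (\<lambda>v. 2 * \<sigma> u v * (?d u)\<^sup>2)) (at u)"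
        unfolding power2_eq_square by (rule has_derivative_eq_rhs) (simp add: fun_eq_iff)
      from has_derivative_mult_right[OF has_derivative_ln[OF _ this], of "1 / 2"]
      show ?thesis using nz[OF u] by (simp add: s_def[abs_def])
    qed
    show "\<rho> u > 0" using fu by (simp add: \<rho>_def)
    have on': "\<theta>1 u (E1 u) = 1" "\<theta>2 u (E1 u) = 0" "\<theta>1 u (E2 u) = 0" "\<theta>2 u (E2 u) = 1"
      using on[OF u] symmetric_g[OF sub[OF u], of "E2 u" "E1 u"]
      by (auto simp: orthonormal_pair_def \<theta>1_def \<theta>2_def)
    have "\<sigma> u (\<rho> u *\<^sub>R E1 u) = 1" "\<theta>2 u (\<rho> u *\<^sub>R E1 u) = 0"
      using on' fu bilinear_lmul[OF bilinear_g[OF sub[OF u]]]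
      by (simp_all add: \<sigma>_def \<theta>1_def \<theta>2_def \<rho>_def)
    then show "\<exists>v. \<sigma> u v = 1 \<and> \<theta>2 u v = 0" by blast
    show "\<exists>v. \<sigma> u v = 0 \<and> \<theta>2 u v = 1" using on' by (intro exI[of _ "E2 u"]) (simp add: \<sigma>_def)
    show "triple (e1 u) (e2 u) (y u) \<noteq> 0" by (rule nz[OF u])
  qed (use r in auto)
  have "u0 \<in> ball u0 r" using r(1) by simp
  from classification[OF this] show ?thesis
    using r(2) by (meson subset_trans)
qed

end

section \<open>Open parts of the model surfaces\<close>

text \<open>Homogeneity: four of the equations set a function of degree 2 under positive scaling
  equal to a nonzero constant, since quotients of coordinates do not change. In the logarithmic one
  a part of degree 1 equals 1/x_1, of degree -1. Either way r^2 = 1.\<close>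

lemma model_surface_radial:
  assumes "model_surface S" "p \<in> S" "r > 0" "r *\<^sub>R p \<in> S"
  shows "r = 1"
proof -
  have sq: "r = 1" if "r\<^sup>2 * c = c" "c \<noteq> 0" for c
    using that \<open>r > 0\<close> by (simp add: power2_eq_1_iff)
  have power: "r = 1" if "S = model_power c \<alpha>" "c \<noteq> 0" for c \<alpha>
  proof (rule sq[OF _ that(2)])
    have p: "p $ 2 > 0" "p $ 3 > 0" and c: "(p $ 2) powr (1 - \<alpha>) * (p $ 3) powr (1 + \<alpha>) - (p $ 1)\<^sup>2 = c"
      and rc: "(r * p $ 2) powr (1 - \<alpha>) * (r * p $ 3) powr (1 + \<alpha>) - (r * p $ 1)\<^sup>2 = c"
      using assms that by (auto simp: model_power_def)
    have "r powr (1 - \<alpha>) * r powr (1 + \<alpha>) = r\<^sup>2"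
      using \<open>r > 0\<close> by (simp add: powr_add[symmetric])
    then have "(r * p $ 2) powr (1 - \<alpha>) * (r * p $ 3) powr (1 + \<alpha>)
        = r\<^sup>2 * ((p $ 2) powr (1 - \<alpha>) * (p $ 3) powr (1 + \<alpha>))"
      using p \<open>r > 0\<close> by (simp add: powr_mult)
    with rc have "r\<^sup>2 * ((p $ 2) powr (1 - \<alpha>) * (p $ 3) powr (1 + \<alpha>)) - r\<^sup>2 * (p $ 1)\<^sup>2 = c"
      by (simp add: power_mult_distrib)
    then show "r\<^sup>2 * c = c" using c by (metis right_diff_distrib)
  qed
  have log: "r = 1" if "S = model_log"
  proof (rule sq)
    have p: "p $ 1 > 0" "p $ 2 > 0" "p $ 3 = 1 / p $ 1 + p $ 1 * (ln (p $ 1) - ln (p $ 2))"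
      and rp: "r * p $ 3 = 1 / (r * p $ 1) + r * p $ 1 * (ln (r * p $ 1) - ln (r * p $ 2))"
      using assms that by (auto simp: model_log_def)
    have "ln (r * p $ 1) - ln (r * p $ 2) = ln (p $ 1) - ln (p $ 2)"
      using p \<open>r > 0\<close> by (simp add: ln_mult)
    with rp p(3) have "r * (1 / p $ 1) = 1 / (r * p $ 1)" by (simp add: algebra_simps)
    then show "r\<^sup>2 * (1 / p $ 1) = 1 / p $ 1"
      using \<open>r > 0\<close> p(1) by (simp add: field_simps power2_eq_square)
    show "1 / p $ 1 \<noteq> 0" using p(1) by simp
  qed
  have exp: "r = 1" if "S = model_exp"
  proof (rule sq)
    have c: "(p $ 3)\<^sup>2 - (p $ 1)\<^sup>2 * exp (- (p $ 2 / p $ 1)) = 1"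
      and rc: "(r * p $ 3)\<^sup>2 - (r * p $ 1)\<^sup>2 * exp (- (p $ 2 / p $ 1)) = 1"
      using assms that by (auto simp: model_exp_def)
    have "r\<^sup>2 * ((p $ 3)\<^sup>2 - (p $ 1)\<^sup>2 * exp (- (p $ 2 / p $ 1))) = 1"
      using rc by (simp add: power_mult_distrib algebra_simps)
    then show "r\<^sup>2 * 1 = 1" unfolding c .
  qed simp
  have arctan: "r = 1" if "S = model_arctan \<alpha>" for \<alpha>
  proof (rule sq)
    have c: "(p $ 3)\<^sup>2 - ((p $ 1)\<^sup>2 + (p $ 2)\<^sup>2) * exp (\<alpha> * arctan (p $ 2 / p $ 1)) = 1"
      and rc: "(r * p $ 3)\<^sup>2 - ((r * p $ 1)\<^sup>2 + (r * p $ 2)\<^sup>2) * exp (\<alpha> * arctan (p $ 2 / p $ 1)) = 1"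
      using assms that by (auto simp: model_arctan_def)
    have "r\<^sup>2 * ((p $ 3)\<^sup>2 - ((p $ 1)\<^sup>2 + (p $ 2)\<^sup>2) * exp (\<alpha> * arctan (p $ 2 / p $ 1))) = 1"
      using rc by (simp add: power_mult_distrib algebra_simps)
    then show "r\<^sup>2 * 1 = 1" unfolding c .
  qed simp
  show ?thesis
    using assms(1) power log exp arctan by (auto simp: model_surface_def)
qed

context hyperbolic_immersion
begin

text \<open>Since the position vector is transversal, \<open>(u, r) \<mapsto> r y(u)\<close> is a local diffeomorphism.\<close>

lemma cone_neighbourhood:
  assumes "open V0" "V0 \<subseteq> \<Omega>" "u0 \<in> V0"
  obtains V T where "open V" "u0 \<in> V" "V \<subseteq> V0" "inj_on y V" "open T" "y ` V \<subseteq> T"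
    "\<And>p. p \<in> T \<Longrightarrow> \<exists>u\<in>V. \<exists>r>0. p = r *\<^sub>R y u"
proof -
  have u0: "u0 \<in> \<Omega>" using assms by blast
  define F where "F = (\<lambda>z :: (real^2) \<times> real. snd z *\<^sub>R y (fst z))"
  define F' where "F' = (\<lambda>z h :: (real^2) \<times> real. snd z *\<^sub>R dd y (fst z) (fst h) + snd h *\<^sub>R y (fst z))"
  let ?a = "(u0, 1 :: real)"
  let ?S = "V0 \<times> {0 :: real <..}"
  have dF: "(F has_derivative F' z) (at z)" if "z \<in> ?S" for z
  proof -
    have "fst z \<in> \<Omega>" using that assms by auto
    have "((\<lambda>z :: (real^2) \<times> real. y (fst z)) has_derivative (\<lambda>h. dd y (fst z) (fst h))) (at z)"
      by (rule has_derivative_compose[where f = fst and g = y and x = z,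
            OF has_derivative_fst[OF has_derivative_ident] smooth_on_has_derivative[OF smooth_y \<open>fst z \<in> \<Omega>\<close>]])
    from has_derivative_scaleR[OF has_derivative_snd[OF has_derivative_ident] this]
    show ?thesis by (simp add: F_def F'_def)
  qed
  have "linear (F' ?a)"
    using has_derivative_linear[OF dF[of ?a]] assms by auto
  moreover have "inj (F' ?a)"
  proof (rule injI)
    fix h h' assume "F' ?a h = F' ?a h'"
    then have "fst h = fst h' \<and> snd h = snd h'" by (intro unique[OF u0]) (simp add: F'_def)
    then show "h = h'" by (simp add: prod_eq_iff)
  qed
  ultimately obtain G where "linear G" "G \<circ> F' ?a = id"
    using linear_injective_left_inverse by blast
  \<comment> \<open>Local injectivity of F requires F' to be continuous at the base point in the
    operator norm. That norm is bounded by the three vector differences in \<open>N\<close>, one for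
    each scalar component of h.\<close>
  have onorm: "\<exists>d>0. \<forall>z. dist ?a z < d \<longrightarrow> onorm (\<lambda>h. F' z h - F' ?a h) < e" if "e > 0" for e
  proof -
    define N where "N z = norm (y (fst z) - y u0) + norm (snd z *\<^sub>R P (fst z) - P u0)
      + norm (snd z *\<^sub>R Q (fst z) - Q u0)" for z :: "(real^2) \<times> real"
    have cy: "isCont y u0" "isCont P u0" "isCont Q u0"
      using smooth_on_differentiable[OF smooth_y u0] smooth_on_differentiable[OF smooth_on_dd[OF smooth_y] u0]
        differentiable_imp_continuous_within by blast+
    have cfst: "isCont (\<lambda>z :: (real^2) \<times> real. h (fst z)) ?a" if "isCont h u0" for h :: "real^2 \<Rightarrow> real^3"
      using continuous_at_compose[of ?a fst h] that by (simp add: o_def)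
    have "isCont N ?a"
      unfolding N_def by (intro continuous_intros cfst cy)
    then obtain d1 where d1: "d1 > 0" "\<And>z. dist z ?a < d1 \<Longrightarrow> dist (N z) (N ?a) < e"
      using \<open>e > 0\<close> unfolding continuous_at_eps_delta by blast
    obtain d2 where d2: "d2 > 0" "ball u0 d2 \<subseteq> \<Omega>" using open_dom u0 open_contains_ball by blast
    have "onorm (\<lambda>h. F' z h - F' ?a h) < e" if z: "dist ?a z < min d1 d2" for z
    proof -
      have "dist u0 (fst z) \<le> dist ?a z" using dist_fst_le[of ?a z] by simp
      then have "fst z \<in> \<Omega>" using z d2 by auto
      have L: "dd y u w = w $ 1 *\<^sub>R P u + w $ 2 *\<^sub>R Q u" if "u \<in> \<Omega>" for u w
        by (rule linear_plane[OF linear_dy[OF that]])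
      have "norm (F' z h - F' ?a h) \<le> N z * norm h" for h
      proof -
        have "F' z h - F' ?a h = snd h *\<^sub>R (y (fst z) - y u0)
            + fst h $ 1 *\<^sub>R (snd z *\<^sub>R P (fst z) - P u0) + fst h $ 2 *\<^sub>R (snd z *\<^sub>R Q (fst z) - Q u0)"
          by (simp add: F'_def L[OF u0, of "fst h"] L[OF \<open>fst z \<in> \<Omega>\<close>, of "fst h"] algebra_simps)
        also have "norm \<dots> \<le> \<bar>snd h\<bar> * norm (y (fst z) - y u0)
            + \<bar>fst h $ 1\<bar> * norm (snd z *\<^sub>R P (fst z) - P u0) + \<bar>fst h $ 2\<bar> * norm (snd z *\<^sub>R Q (fst z) - Q u0)"
          by (intro norm_triangle_le add_mono) simp_all
        also have "\<dots> \<le> norm h * norm (y (fst z) - y u0)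
            + norm h * norm (snd z *\<^sub>R P (fst z) - P u0) + norm h * norm (snd z *\<^sub>R Q (fst z) - Q u0)"
        proof (intro add_mono mult_right_mono)
          show "\<bar>snd h\<bar> \<le> norm h" using norm_snd_le[of "snd h" "fst h"] by simp
          show "\<bar>fst h $ 1\<bar> \<le> norm h" "\<bar>fst h $ 2\<bar> \<le> norm h"
            using norm_fst_le[of "fst h" "snd h"] component_le_norm_cart[of "fst h" 1]
              component_le_norm_cart[of "fst h" 2] by simp_all
        qed auto
        finally show ?thesis by (simp add: N_def algebra_simps)
      qed
      then have "onorm (\<lambda>h. F' z h - F' ?a h) \<le> N z"
        by (intro onorm_bound) (simp_all add: N_def)
      also have "N z < e"
        using d1(2)[of z] z by (simp add: N_def dist_commute)
      finally show ?thesis .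
    qed
    then show ?thesis using d1(1) d2(1) by (intro exI[of _ "min d1 d2"]) auto
  qed
  have "open ?S" using assms(1) by (intro open_Times) auto
  obtain r where r: "r > 0" "ball ?a r \<subseteq> ?S" "inj_on F (ball ?a r)"
    by (rule has_derivative_locally_injective[of ?a ?S G F' F, OF _ \<open>open ?S\<close> _ \<open>G \<circ> F' ?a = id\<close> dF onorm])
      (use assms \<open>linear G\<close> linear_conv_bounded_linear in auto)
  \<comment> \<open>Radius r/2 in each factor keeps the product inside the ball of radius r; the
    slice at height 1 is a copy of \<open>V\<close>.\<close>
  define V where "V = ball u0 (r / 2)"
  define D where "D = V \<times> ball (1 :: real) (r / 2)"
  have "D \<subseteq> ball ?a r"
  proof
    fix z assume "z \<in> D"
    then have "dist u0 (fst z) < r / 2" "dist 1 (snd z) < r / 2" by (auto simp: D_def V_def)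
    moreover have "dist ?a z \<le> dist u0 (fst z) + dist 1 (snd z)"
      using sqrt_sum_squares_le_sum[of "dist u0 (fst z)" "dist 1 (snd z)"] by (simp add: dist_prod_def)
    ultimately show "z \<in> ball ?a r" by simp
  qed
  then have D: "D \<subseteq> ?S" "inj_on F D" using r inj_on_subset by blast+
  have one: "(u, 1) \<in> D" if "u \<in> V" for u using that r(1) by (simp add: D_def)
  have "continuous_on D F"
    using dF D(1) has_derivative_continuous by (intro continuous_at_imp_continuous_on) blast
  moreover have "open D" by (simp add: D_def V_def open_Times)
  \<comment> \<open>Invariance of domain: F is continuous and injective between spaces of dimension
    3.\<close>
  ultimately have "open (F ` D)"
    using D(2) by (intro invariance_of_domain_gen) simp_all
  show thesis
  proof (rule that[of V "F ` D"])
    show "open V" "u0 \<in> V" using r(1) by (simp_all add: V_def)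
    show "V \<subseteq> V0" using one D(1) by blast
    show "inj_on y V"
    proof (rule inj_onI)
      fix u v assume "u \<in> V" "v \<in> V" "y u = y v"
      then have "F (u, 1) = F (v, 1)" by (simp add: F_def)
      then show "u = v" using inj_onD[OF D(2)] one \<open>u \<in> V\<close> \<open>v \<in> V\<close> by blast
    qed
    show "open (F ` D)" by fact
    show "y ` V \<subseteq> F ` D"
    proof
      fix p assume "p \<in> y ` V"
      then obtain u where "u \<in> V" "p = F (u, 1)" by (auto simp: F_def)
      then show "p \<in> F ` D" using one by blast
    qed
    show "\<exists>u\<in>V. \<exists>r>0. p = r *\<^sub>R y u" if "p \<in> F ` D" for p
    proof -
      from that obtain u c where "(u, c) \<in> D" "p = c *\<^sub>R y u" by (auto simp: F_def)
      moreover from this have "u \<in> V" by (simp add: D_def)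
      moreover from \<open>(u, c) \<in> D\<close> have "c > 0" using D(1) by blast
      ultimately show ?thesis by blast
    qed
  qed
qed

text \<open>A point of \<open>S\<close> in the open cone over the transformed patch has the form r B
  y(u). Since B y(u) also lies on \<open>S\<close>, radial uniqueness gives r = 1, so the image is
  \<open>S\<close> intersected with an open set.\<close>

lemma open_part:
  assumes "open V0" "V0 \<subseteq> \<Omega>" "u0 \<in> V0" and B: "invertible (B :: real^3^3)"
    and S: "model_surface S" "\<And>u. u \<in> V0 \<Longrightarrow> B *v y u \<in> S"
  obtains V where "open V" "u0 \<in> V" "V \<subseteq> V0" "inj_on y V"
    "openin (top_of_set S) ((\<lambda>u. B *v y u) ` V)"
proof -
  obtain V T where V: "open V" "u0 \<in> V" "V \<subseteq> V0" "inj_on y V" and T: "open T" "y ` V \<subseteq> T"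
    "\<And>p. p \<in> T \<Longrightarrow> \<exists>u\<in>V. \<exists>r>0. p = r *\<^sub>R y u"
    using cone_neighbourhood[OF assms(1-3)] by metis
  obtain A where A: "A ** B = mat 1" "B ** A = mat 1" using B by (auto simp: invertible_def)
  have AB: "A *v (B *v p) = p" "B *v (A *v p) = p" for p
    using A by (simp_all add: matrix_vector_mul_assoc)
  have "(\<lambda>u. B *v y u) ` V = S \<inter> (\<lambda>p. A *v p) -` T"
  proof (intro subset_antisym subsetI)
    fix p assume "p \<in> (\<lambda>u. B *v y u) ` V"
    then show "p \<in> S \<inter> (\<lambda>p. A *v p) -` T" using S(2) V(3) T(2) AB by auto
  next
    fix p assume "p \<in> S \<inter> (\<lambda>p. A *v p) -` T"
    then have "p \<in> S" "A *v p \<in> T" by auto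
    then obtain u r where u: "u \<in> V" "r > 0" "A *v p = r *\<^sub>R y u" using T(3) by blast
    have p: "p = r *\<^sub>R (B *v y u)" using AB(2)[of p] u(3) by (simp add: matrix_vector_mult_scaleR)
    have "r = 1"
      using model_surface_radial[OF S(1) S(2) u(2)] u(1) V(3) \<open>p \<in> S\<close> unfolding p by blast
    then show "p \<in> (\<lambda>u. B *v y u) ` V" using p u(1) by simp
  qed
  moreover have "open ((\<lambda>p. A *v p) -` T)"
    using T(1) by (intro open_vimage linear_continuous_on matrix_vector_mul_bounded_linear)
  ultimately have "openin (top_of_set S) ((\<lambda>u. B *v y u) ` V)"
    by (simp add: openin_open_Int)
  with V show thesis by (rule that)
qed

end

section \<open>Passage from charts to the surface\<close>

theorem theorem6p2:
  fixes M :: "'a topology"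
    and A :: "('a set \<times> ('a \<Rightarrow> real^2)) set"
    and x :: "'a \<Rightarrow> real^3"
  assumes surface: "smooth_surface M A"
    and hyperbolic: "\<And>U \<phi>. (U, \<phi>) \<in> A \<Longrightarrow>
          hyperbolic_centroaffine (\<phi> ` U) (x \<circ> inv_into U \<phi>)"
    and extremal: "\<And>U \<phi>. (U, \<phi>) \<in> A \<Longrightarrow>
          centroaffine_extremal (-1) (\<phi> ` U) (x \<circ> inv_into U \<phi>)"
    and curvature: "\<And>U \<phi> u. (U, \<phi>) \<in> A \<Longrightarrow> u \<in> \<phi> ` U \<Longrightarrow>
          gauss_curvature (centroaffine_metric (-1) (x \<circ> inv_into U \<phi>)) u = -1"
    and frame: "\<And>U \<phi> p. (U, \<phi>) \<in> A \<Longrightarrow> p \<in> \<phi> ` U \<Longrightarrow>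
          \<exists>W E1 E2 (f1 :: real^2 \<Rightarrow> real) f2.
            open W \<and> p \<in> W \<and> W \<subseteq> \<phi> ` U \<and>
            orthonormal_frame (centroaffine_metric (-1) (x \<circ> inv_into U \<phi>)) W E1 E2 \<and>
            (let K = difference_tensor (-1) (x \<circ> inv_into U \<phi>) in
             \<forall>u\<in>W. K E1 E1 u = f1 u *\<^sub>R E1 u \<and> f1 u > 0 \<and>
                   K E1 E2 u = 0 \<and>
                   K E2 E2 u = f2 u *\<^sub>R E2 u \<and> f2 u = 0)"
  shows "\<forall>q\<in>topspace M. \<exists>V S. openin M V \<and> q \<in> V \<and>
           centroaffinely_equivalent_to_open_part V x S \<and>
           (S = model_log \<or>
            (\<exists>\<alpha>. 0 < \<alpha> \<and> \<alpha> < 1 \<and> S = model_power 1 \<alpha>) \<or>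
            (\<exists>\<alpha>. \<alpha> > 1 \<and> S = model_power (-1) \<alpha>) \<or>
            S = model_exp \<or>
            (\<exists>\<alpha>. \<alpha> < 0 \<and> S = model_arctan \<alpha>))"
proof
  fix q assume "q \<in> topspace M"
  then obtain U \<phi> where A: "(U, \<phi>) \<in> A" and "q \<in> U"
    using surface unfolding smooth_surface_def by blast
  have U: "openin M U" "open (\<phi> ` U)" "homeomorphic_map (subtopology M U) (top_of_set (\<phi> ` U)) \<phi>"
    using surface A unfolding smooth_surface_def by auto
  have top: "topspace (subtopology M U) = U" using openin_subset[OF U(1)] by auto
  have inj: "inj_on \<phi> U"
    using homeomorphic_imp_injective_map[OF U(3)] unfolding top .
  define y where "y = x \<circ> inv_into U \<phi>"
  have xy: "x a = y (\<phi> a)" if "a \<in> U" for a using inj that by (simp add: y_def)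
  \<comment> \<open>The conclusion is local around \<open>q\<close>, so the coordinate
    representation in one chart suffices.\<close>
  interpret hyperbolic_immersion "\<phi> ` U" y
    by unfold_locales (use U hyperbolic[OF A] in \<open>simp_all add: y_def\<close>)
  have "\<phi> q \<in> \<phi> ` U" using \<open>q \<in> U\<close> by simp
  from frame[OF A this] obtain W E1 E2 f1 and f2 :: "real^2 \<Rightarrow> real"
    where W: "open W" "\<phi> q \<in> W" "W \<subseteq> \<phi> ` U" and fr: "orthonormal_frame g W E1 E2"
      and "\<forall>u\<in>W. difference_tensor (-1) y E1 E1 u = f1 u *\<^sub>R E1 u \<and> f1 u > 0 \<and>
        difference_tensor (-1) y E1 E2 u = 0 \<and> difference_tensor (-1) y E2 E2 u = f2 u *\<^sub>R E2 u \<and> f2 u = 0"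
    unfolding y_def[symmetric] Let_def by metis
  then have K: "\<And>u. u \<in> W \<Longrightarrow> difference_tensor (-1) y E1 E1 u = f1 u *\<^sub>R E1 u"
      "\<And>u. u \<in> W \<Longrightarrow> f1 u > 0"
      "\<And>u. u \<in> W \<Longrightarrow> difference_tensor (-1) y E1 E2 u = 0"
      "\<And>u. u \<in> W \<Longrightarrow> difference_tensor (-1) y E2 E2 u = 0"
    by auto
  obtain V0 S and B :: "real^3^3" where V0: "open V0" "V0 \<subseteq> W" "\<phi> q \<in> V0"
    and B: "invertible B" "\<And>u. u \<in> V0 \<Longrightarrow> B *v y u \<in> S" and S: "model_surface S"
    using local_model[OF W(1,3) fr K(1,3,4,2) extremal[OF A, folded y_def] W(2)] by blast
  have "V0 \<subseteq> \<phi> ` U" using V0 W by blast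
  obtain V1 where V1: "open V1" "\<phi> q \<in> V1" "V1 \<subseteq> V0" "inj_on y V1"
    "openin (top_of_set S) ((\<lambda>u. B *v y u) ` V1)"
    using open_part[OF V0(1) \<open>V0 \<subseteq> \<phi> ` U\<close> V0(3) B(1) S B(2)] by blast
  define V where "V = {a \<in> U. \<phi> a \<in> V1}"
  have "openin (top_of_set (\<phi> ` U)) V1"
    using V1(1,3) \<open>V0 \<subseteq> \<phi> ` U\<close> by (intro open_subset) auto
  then have "openin (subtopology M U) V"
    using openin_continuous_map_preimage[OF homeomorphic_imp_continuous_map[OF U(3)]]
    unfolding top V_def by blast
  then have "openin M V" using openin_trans_full U(1) by blast
  moreover have "q \<in> V" using \<open>q \<in> U\<close> V1(2) by (simp add: V_def)
  moreover have "centroaffinely_equivalent_to_open_part V x S"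
    unfolding centroaffinely_equivalent_to_open_part_def
  proof (intro exI conjI)
    show "invertible B" by (rule B(1))
    have "inj_on (\<lambda>a. y (\<phi> a)) V"
      using V1(4) inj by (auto simp: V_def inj_on_def)
    then show "inj_on x V" using xy by (simp add: V_def inj_on_def)
    \<comment> \<open>The immersion on \<open>V\<close> and its representation on \<open>V1\<close>
      have the same image, which carries openness in \<open>S\<close> over to the surface.\<close>
    have "V1 = \<phi> ` V" using V1(3) \<open>V0 \<subseteq> \<phi> ` U\<close> by (auto simp: V_def)
    then have "(\<lambda>u. B *v y u) ` V1 = (\<lambda>a. B *v y (\<phi> a)) ` V" by (simp add: image_image)
    also have "\<dots> = (\<lambda>a. B *v x a) ` V" using xy by (intro image_cong) (simp_all add: V_def)
    finally have "(\<lambda>u. B *v y u) ` V1 = (\<lambda>a. B *v x a) ` V" .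
    then show "openin (top_of_set S) ((\<lambda>a. B *v x a) ` V)" using V1(5) by simp
  qed
  ultimately show "\<exists>V S. openin M V \<and> q \<in> V \<and>
           centroaffinely_equivalent_to_open_part V x S \<and>
           (S = model_log \<or>
            (\<exists>\<alpha>. 0 < \<alpha> \<and> \<alpha> < 1 \<and> S = model_power 1 \<alpha>) \<or>
            (\<exists>\<alpha>. \<alpha> > 1 \<and> S = model_power (-1) \<alpha>) \<or>
            S = model_exp \<or>
            (\<exists>\<alpha>. \<alpha> < 0 \<and> S = model_arctan \<alpha>))"
    using S unfolding model_surface_def by blast
qed

end
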